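(* Let $V$ be a finite-dimensional real vector space equipped with a Euclidean structure, let $\mu$ be a probability measure on $\mathrm{GL}(V)$ with finite first moment, and let $\mu^{t}$ denote the image of $\mu$ by the transpose map. Let $F_2(\mu^t)$ be the second Furstenberg--Kifer--Hennion space of $\mu^t$ in $V$ and let $V_{1,\mu}:=F_2(\mu^t)^{\perp}$. Then any $\mu$-stationary probability measure $\nu$ on $P(V)$ with $\alpha(\nu)=\lambda_1(\mu)$ is supported in $P(V_{1,\mu})$.
   Context: Measures are Borel; fix any norm on $V$. A probability measure $\mu$ on $\mathrm{GL}(V)$ has finite first moment if $\int \log\max\{\|g\|,\|g^{-1}\|\}\,d\mu(g)<\infty$. A probability measure $\nu$ on $P(V)$ is $\mu$-stationary if $\mu*\nu=\nu$, where $\int f\,d(\mu*\nu)=\iint f(gx)\,d\mu(g)\,d\nu(x)$, and ergodic if it is extremal among $\mu$-stationary probability measures. Its cocycle average is $\alpha(\nu)=\iint\log\frac{\|gv\|}{\|v\|}\,d\mu(g)\,d\nu([v])$. The top Lyapunov exponent $\lambda_1(\mu)$ is the a.s. limit of $\frac1n\log\|X_n\cdots X_1\|$ with $X_i$ iid of law $\mu$. Furstenberg--Kifer--Hennion (FKH) exponents and spaces of a probability measure $\eta$ on $\mathrm{GL}(V)$ with finite first moment: as $\nu$ ranges over ergodic $\eta$-stationary probability measures on $P(V)$, its cocycle average (with respect to $\eta$) takes finitely many values $\beta_1(\eta)>\cdots>\beta_k(\eta)>-\infty$. $F_i(\eta)$ is the subspace invariant under the support of $\eta$ which is maximal for the property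 that the top Lyapunov exponent of $\eta$ on it is $\beta_i(\eta)$. One has $V=F_1(\eta)\supsetneq\cdots\supsetneq F_k(\eta)\supsetneq F_{k+1}(\eta):=\{0\}$ (so $F_2(\eta)=\{0\}$ if $k=1$), and $F_2(\eta)$ consists of those $v$ for which the almost sure exponential growth rate of $\|Y_n\cdots Y_1v\|$ ($Y_i$ iid of law $\eta$) is strictly smaller than $\lambda_1(\eta)=\beta_1(\eta)$. The transpose is taken with respect to the Euclidean structure, as is $\perp$. *)

theory Defs
  imports "HOL-Probability.Probability"
begin

section \<open>The general linear group\<close>

definition GL :: "('a::euclidean_space \<Rightarrow>\<^sub>L 'a) set" where
  "GL = {g. bij (blinfun_apply g)}"

definition GL_borel :: "('a::euclidean_space \<Rightarrow>\<^sub>L 'a) measure" where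
  "GL_borel = restrict_space borel GL"

definition prob_on_GL :: "('a::euclidean_space \<Rightarrow>\<^sub>L 'a) measure \<Rightarrow> bool" where
  "prob_on_GL \<mu> \<longleftrightarrow> prob_space \<mu> \<and> sets \<mu> = sets GL_borel"

definition finite_first_moment :: "('a::euclidean_space \<Rightarrow>\<^sub>L 'a) measure \<Rightarrow> bool" where
  "finite_first_moment \<mu> \<longleftrightarrow>
     integrable \<mu> (\<lambda>g. ln (max (norm g) (onorm (inv (blinfun_apply g)))))"

definition transpose_blinfun :: "('a::euclidean_space \<Rightarrow>\<^sub>L 'a) \<Rightarrow> ('a \<Rightarrow>\<^sub>L 'a)" where
  "transpose_blinfun g = Blinfun (adjoint (blinfun_apply g))"

definition transpose_measure ::
  "('a::euclidean_space \<Rightarrow>\<^sub>L 'a) measure \<Rightarrow> ('a \<Rightarrow>\<^sub>L 'a) measure" where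
  "transpose_measure \<mu> = distr \<mu> GL_borel transpose_blinfun"

definition GL_support :: "('a::euclidean_space \<Rightarrow>\<^sub>L 'a) measure \<Rightarrow> ('a \<Rightarrow>\<^sub>L 'a) set" where
  "GL_support \<mu> = {g \<in> GL. \<forall>U. open U \<and> g \<in> U \<longrightarrow> emeasure \<mu> (U \<inter> GL) > 0}"


section \<open>Projective space\<close>

text \<open>A point of the projective space is a line of the vector space, as a set of vectors.\<close>

definition proj :: "'a::euclidean_space set \<Rightarrow> 'a set set" where
  "proj W = {span {v} | v. v \<in> W \<and> v \<noteq> 0}"

text \<open>The Borel sets of the quotient topology: a set of lines is open iff the set of non-zero
  vectors spanning one of its lines is open.\<close>

definition proj_borel :: "'a::euclidean_space set measure" where
  "proj_borel = sigma (proj UNIV) {U. U \<subseteq> proj UNIV \<and> open {v. v \<noteq> 0 \<and> span {v} \<in> U}}"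

definition proj_act :: "('a::euclidean_space \<Rightarrow>\<^sub>L 'a) \<Rightarrow> 'a set \<Rightarrow> 'a set" where
  "proj_act g L = blinfun_apply g ` L"

definition convolve ::
  "('a::euclidean_space \<Rightarrow>\<^sub>L 'a) measure \<Rightarrow> 'a set measure \<Rightarrow> 'a set measure" where
  "convolve \<mu> \<nu> = distr (\<mu> \<Otimes>\<^sub>M \<nu>) proj_borel (\<lambda>(g, L). proj_act g L)"

definition stationary ::
  "('a::euclidean_space \<Rightarrow>\<^sub>L 'a) measure \<Rightarrow> 'a set measure \<Rightarrow> bool" where
  "stationary \<mu> \<nu> \<longleftrightarrow> prob_space \<nu> \<and> sets \<nu> = sets proj_borel \<and> convolve \<mu> \<nu> = \<nu>"

definition ergodic_stationary ::
  "('a::euclidean_space \<Rightarrow>\<^sub>L 'a) measure \<Rightarrow> 'a set measure \<Rightarrow> bool" where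
  "ergodic_stationary \<mu> \<nu> \<longleftrightarrow> stationary \<mu> \<nu> \<and>
     (\<forall>\<nu>1 \<nu>2 t. stationary \<mu> \<nu>1 \<and> stationary \<mu> \<nu>2 \<and> 0 < t \<and> t < 1 \<and>
        (\<forall>A \<in> sets proj_borel. measure \<nu> A = t * measure \<nu>1 A + (1 - t) * measure \<nu>2 A)
        \<longrightarrow> \<nu>1 = \<nu> \<and> \<nu>2 = \<nu>)"

text \<open>The common value of \<open>ln (norm (g v) / norm v)\<close> over all non-zero \<open>v\<close> in the line \<open>L\<close>;
  see \<open>log_cocycle_span\<close>.\<close>

definition log_cocycle :: "('a::euclidean_space \<Rightarrow>\<^sub>L 'a) \<Rightarrow> 'a set \<Rightarrow> real" where
  "log_cocycle g L =
     (THE c. \<forall>v \<in> L - {0}. c = ln (norm (blinfun_apply g v) / norm v))"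

lemma log_cocycle_span:
  assumes "v \<noteq> 0"
  shows "log_cocycle g (span {v}) = ln (norm (blinfun_apply g v) / norm v)"
proof -
  let ?f = "\<lambda>w. ln (norm (blinfun_apply g w) / norm w)"
  have *: "?f w = ?f v" if "w \<in> span {v} - {0}" for w
  proof -
    obtain k where "w = k *\<^sub>R v" "k \<noteq> 0"
      using \<open>w \<in> span {v} - {0}\<close> by (auto simp: span_singleton)
    then show ?thesis by (simp add: blinfun.scaleR_right)
  qed
  have v: "v \<in> span {v} - {0}"
    using assms by (simp add: span_base)
  show ?thesis
    unfolding log_cocycle_def
  proof (rule the_equality)
    show "\<forall>w \<in> span {v} - {0}. ?f v = ?f w"
      by (intro ballI) (rule *[symmetric])
    show "c = ?f v" if "\<forall>w \<in> span {v} - {0}. c = ?f w" for c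
      using that v by (rule bspec)
  qed
qed

definition cocycle_average ::
  "('a::euclidean_space \<Rightarrow>\<^sub>L 'a) measure \<Rightarrow> 'a set measure \<Rightarrow> real" where
  "cocycle_average \<mu> \<nu> = (\<integral>L. (\<integral>g. log_cocycle g L \<partial>\<mu>) \<partial>\<nu>)"


section \<open>Lyapunov exponents\<close>

text \<open>The factors \<open>X\<^sub>1, X\<^sub>2, \<dots>\<close> are \<open>\<omega> 0, \<omega> 1, \<dots>\<close>, so that \<open>rand_prod \<omega> n\<close> is
  \<open>X\<^sub>n \<cdots> X\<^sub>1\<close>.\<close>

primrec rand_prod ::
  "(nat \<Rightarrow> ('a::euclidean_space \<Rightarrow>\<^sub>L 'a)) \<Rightarrow> nat \<Rightarrow> ('a \<Rightarrow>\<^sub>L 'a)" where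
  "rand_prod \<omega> 0 = id_blinfun"
| "rand_prod \<omega> (Suc n) = \<omega> n o\<^sub>L rand_prod \<omega> n"

definition norm_on :: "'a::euclidean_space set \<Rightarrow> ('a \<Rightarrow>\<^sub>L 'a) \<Rightarrow> real" where
  "norm_on W g = (SUP v\<in>W. norm (blinfun_apply g v) / norm v)"

lemma norm_on_UNIV: "norm_on UNIV g = norm g"
  by (simp add: norm_on_def norm_blinfun.rep_eq onorm_def)

text \<open>The top Lyapunov exponent on an invariant subspace; only meaningful if \<open>W \<noteq> {0}\<close>.\<close>

definition top_lyapunov_on ::
  "('a::euclidean_space \<Rightarrow>\<^sub>L 'a) measure \<Rightarrow> 'a set \<Rightarrow> real" where
  "top_lyapunov_on \<mu> W =
     (THE l. AE \<omega> in (\<Pi>\<^sub>M i\<in>(UNIV :: nat set). \<mu>).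
        (\<lambda>n. ln (norm_on W (rand_prod \<omega> n)) / real n) \<longlonglongrightarrow> l)"

abbreviation top_lyapunov :: "('a::euclidean_space \<Rightarrow>\<^sub>L 'a) measure \<Rightarrow> real" where
  "top_lyapunov \<mu> \<equiv> top_lyapunov_on \<mu> UNIV"


section \<open>Furstenberg--Kifer--Hennion exponents and spaces\<close>

definition FKH_exponents :: "('a::euclidean_space \<Rightarrow>\<^sub>L 'a) measure \<Rightarrow> real set" where
  "FKH_exponents \<eta> = {cocycle_average \<eta> \<nu> | \<nu>. ergodic_stationary \<eta> \<nu>}"

text \<open>\<open>b\<close> is the \<open>i\<close>-th largest exponent, for \<open>i \<ge> 1\<close>. The cardinality of an infinite set being
  \<open>0\<close>, this includes that only finitely many exponents are at least \<open>b\<close>.\<close>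

definition is_FKH_exponent ::
  "('a::euclidean_space \<Rightarrow>\<^sub>L 'a) measure \<Rightarrow> nat \<Rightarrow> real \<Rightarrow> bool" where
  "is_FKH_exponent \<eta> i b \<longleftrightarrow>
     1 \<le> i \<and> b \<in> FKH_exponents \<eta> \<and> card {c \<in> FKH_exponents \<eta>. b \<le> c} = i"

definition invariant_subspace ::
  "('a::euclidean_space \<Rightarrow>\<^sub>L 'a) measure \<Rightarrow> 'a set \<Rightarrow> bool" where
  "invariant_subspace \<eta> W \<longleftrightarrow>
     subspace W \<and> (\<forall>g \<in> GL_support \<eta>. blinfun_apply g ` W \<subseteq> W)"

definition has_FKH_exponent ::
  "('a::euclidean_space \<Rightarrow>\<^sub>L 'a) measure \<Rightarrow> nat \<Rightarrow> 'a set \<Rightarrow> bool" where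
  "has_FKH_exponent \<eta> i W \<longleftrightarrow> invariant_subspace \<eta> W \<and> W \<noteq> {0} \<and>
     is_FKH_exponent \<eta> i (top_lyapunov_on \<eta> W)"

definition is_FKH_space ::
  "('a::euclidean_space \<Rightarrow>\<^sub>L 'a) measure \<Rightarrow> nat \<Rightarrow> 'a set \<Rightarrow> bool" where
  "is_FKH_space \<eta> i W \<longleftrightarrow> has_FKH_exponent \<eta> i W \<and>
     (\<forall>W'. has_FKH_exponent \<eta> i W' \<longrightarrow> W' \<subseteq> W)"

text \<open>If \<open>\<eta>\<close> has finite first moment and exactly \<open>k\<close> exponents, then the space exists for
  \<open>1 \<le> i \<le> k\<close> by the theorem of Furstenberg--Kifer and Hennion; the other branch is the
  convention that the \<open>(k+1)\<close>-st space is \<open>{0}\<close>.\<close>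

definition FKH_space ::
  "('a::euclidean_space \<Rightarrow>\<^sub>L 'a) measure \<Rightarrow> nat \<Rightarrow> 'a set" where
  "FKH_space \<eta> i =
     (if \<exists>W. is_FKH_space \<eta> i W then THE W. is_FKH_space \<eta> i W else {0})"

end

theory Submission
  imports Defs
begin

text \<open>
  Write \<open>W\<close> for the second Furstenberg--Kifer--Hennion space of the transposed measure, \<open>b\<close> for
  the top exponent of the transposed walk on \<open>W\<close>, and \<open>\<Lambda>\<close> for the top exponent of \<open>\<mu>\<close>. If no
  such space exists, the claim is that \<open>\<nu>\<close> has mass one. Otherwise let \<open>t\<close> be the mass that \<open>\<nu>\<close>
  gives to the lines which are not orthogonal to \<open>W\<close>; the claim is \<open>t = 0\<close>.

  The gap. The exponent \<open>b\<close> is second in the list of averages of ergodic stationary measures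
  of the transposed walk, so some stationary measure has a larger average. No average exceeds the top
  exponent of the walk, and the transposed walk has the same top exponent \<open>\<Lambda>\<close>: transposing a
  product reverses the order of its factors, which does not change its law, and preserves the
  norm (\<open>mean_log_norm_transpose\<close>). Hence \<open>b < \<Lambda>\<close>.

  The recurrence argument. Let \<open>p\<close> be the orthogonal projection onto \<open>W\<close>. The orthogonal
  complement of \<open>W\<close> is invariant under the walk, and the walk on the quotient by it is dual to
  the transposed walk on \<open>W\<close>: the norm of \<open>p (g v)\<close> is at most the norm of \<open>p v\<close> times the norm
  on \<open>W\<close> of the transpose of \<open>g\<close>. On the lines that are not orthogonal to \<open>W\<close> consider the
  nonnegative function \<open>\<phi> [v] = ln (norm v / norm (p v))\<close>. Its increment from a line to its
  image under \<open>g\<close> is at least the cocycle minus the logarithm of that norm on \<open>W\<close>. The image of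
  a \<open>\<nu>\<close>-random line under an independent \<open>g\<close> has again law \<open>\<nu>\<close>, and a nonnegative function cannot
  gain in the mean between two variables of equal law, even if it is not integrable
  (\<open>integral_le_0_of_equal_laws\<close>). So on these lines the cocycle contributes at most \<open>t\<close> times
  the mean logarithm of the norm on \<open>W\<close>; on the other lines it contributes at most \<open>1 - t\<close> times
  the mean logarithm of the norm of \<open>g\<close> (\<open>cocycle_average_split\<close>).

  For \<open>n\<close> steps of the walk the average of the cocycle is \<open>n \<Lambda>\<close>, as \<open>\<nu>\<close> has average \<open>\<Lambda>\<close>. Dividing
  by \<open>n\<close> and letting \<open>n\<close> grow yields \<open>\<Lambda> \<le> (1 - t) \<Lambda> + t b\<close>, and \<open>b < \<Lambda>\<close> forces \<open>t = 0\<close>.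

  Lyapunov exponents are almost sure limits, whereas this argument only uses means. The two are
  connected by the Furstenberg--Kesten theorem (\<open>furstenberg_kesten\<close>), an instance of the
  subadditive ergodic theorem for the Bernoulli shift.
\<close>

section \<open>The subadditive ergodic theorem\<close>

lemma liminf_le_frequently:
  fixes u :: "nat \<Rightarrow> real"
  assumes "liminf (\<lambda>n. ereal (u n)) \<le> ereal c" "c < d"
  shows "\<exists>n\<ge>N. u n < d"
proof (rule ccontr)
  assume "\<not> ?thesis"
  then have "eventually (\<lambda>n. ereal d \<le> ereal (u n)) sequentially"
    by (auto simp: eventually_sequentially not_less)
  then have "ereal d \<le> liminf (\<lambda>n. ereal (u n))" by (rule Liminf_bounded)
  with assms show False by (metis ereal_less_eq(3) leD order_trans)
qed

locale measure_preserving_map = prob_space M for M :: "'a measure" +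
  fixes T :: "'a \<Rightarrow> 'a"
  assumes T_measurable [measurable]: "T \<in> measurable M M"
    and T_preserving: "distr M M T = M"
begin

lemma iterate_measurable [measurable]: "T ^^ n \<in> measurable M M"
  by (induction n) (auto simp: id_def[symmetric] intro: measurable_comp[OF _ T_measurable])

lemma iterate_preserving: "distr M M (T ^^ n) = M"
proof (induction n)
  case (Suc n)
  have "distr M M (T ^^ Suc n) = distr (distr M M (T ^^ n)) M T"
    by (subst distr_distr) (auto simp: comp_def)
  then show ?case using Suc T_preserving by (simp only:)
qed (simp add: id_def distr_id)

lemma AE_iterate: 
  assumes "AE x in M. P x"
  shows "AE x in M. P ((T ^^ n) x)"
  using AE_distrD[OF iterate_measurable[of n], of P] assms unfolding iterate_preserving by blast

lemma AE_orbit: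
  assumes "AE x in M. P x"
  shows "AE x in M. \<forall>n. P ((T ^^ n) x)"
  using AE_iterate[OF assms] by (simp add: AE_all_countable)

lemma integrable_iterate:
  fixes h :: "'a \<Rightarrow> real"
  assumes "integrable M h"
  shows "integrable M (\<lambda>x. h ((T ^^ n) x))"
  by (rule integrable_distr[OF iterate_measurable[of n]]) (simp add: iterate_preserving assms)

lemma integral_iterate:
  fixes h :: "'a \<Rightarrow> real"
  assumes "integrable M h"
  shows "(\<integral>x. h ((T ^^ n) x) \<partial>M) = (\<integral>x. h x \<partial>M)"
  using integral_distr[OF iterate_measurable[of n], of h] assms by (simp add: iterate_preserving)

lemma prob_vimage_iterate:
  assumes "A \<in> sets M"
  shows "prob ((T ^^ n) -` A \<inter> space M) = prob A"
  using measure_distr[OF iterate_measurable[of n] assms] by (simp add: iterate_preserving)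

end

text \<open>Ergodicity is required in the form in which it is used below: sets that contain their own
  preimage almost everywhere are trivial. This is what the sublevel sets of the lower limit of a
  subadditive process satisfy.\<close>

locale ergodic_map = measure_preserving_map +
  assumes zero_one: "A \<in> sets M \<Longrightarrow> AE x in M. T x \<in> A \<longrightarrow> x \<in> A \<Longrightarrow> prob A = 0 \<or> prob A = 1"

text \<open>Subadditivity along orbits is only required almost everywhere, because the norm on a
  subspace is submultiplicative only for maps that preserve the subspace.\<close>

definition (in measure_preserving_map) subadditive :: "(nat \<Rightarrow> 'a \<Rightarrow> real) \<Rightarrow> bool" where
  "subadditive f \<longleftrightarrow> (\<forall>n. integrable M (f n)) \<and> 
     (AE x in M. f 0 x = 0 \<and> (\<forall>m n. f (m + n) x \<le> f m x + f n ((T ^^ m) x)))"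

text \<open>The combinatorial core of the lower bound, due to Katznelson and Weiss. Here \<open>a k n\<close> stands for
  the process over the orbit segment of length \<open>n\<close> that starts at time \<open>k\<close>. Cut the segment
  greedily: from a good time jump over a block of length at most \<open>N\<close> on which the process is at
  most \<open>c\<close> times the length; from a bad time, or within distance \<open>N\<close> of the end, move one step
  and pay the cost of that step.\<close>

lemma orbit_greedy_bound:
  fixes a :: "nat \<Rightarrow> nat \<Rightarrow> real"
  assumes sub: "\<And>k m n. a k (m + n) \<le> a k m + a (k + m) n"
    and zero: "\<And>k. a k 0 = 0"
    and good: "\<And>k. k \<notin> B \<Longrightarrow> \<exists>n\<in>{1..N}. a k n \<le> real n * c"
  shows "a k n \<le> real n * c + (\<Sum>i=k..<k+n. if i \<in> B \<or> k + n < i + N then \<bar>a i 1\<bar> + \<bar>c\<bar> else 0)"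
proof (induction n arbitrary: k rule: less_induct)
  case (less n)
  let ?w = "\<lambda>i. if i \<in> B \<or> k + n < i + N then \<bar>a i 1\<bar> + \<bar>c\<bar> else 0"
  have split: "a k n \<le> a k m + (real (n - m) * c + (\<Sum>i=k+m..<k+n. ?w i))" 
    if m: "1 \<le> m" "m \<le> n" for m
  proof -
    have "a k n \<le> a k m + a (k + m) (n - m)" using sub[of k m "n - m"] m by simp
    moreover have "a (k + m) (n - m) \<le> real (n - m) * c + (\<Sum>i=k+m..<k+n. ?w i)"
      using less[of "n - m" "k + m"] m by simp
    ultimately show ?thesis by simp
  qed
  consider "n = 0" | "n \<ge> 1" "k \<in> B \<or> n < N" | "n \<ge> 1" "k \<notin> B" "N \<le> n" by linarith
  then show ?case
  proof cases
    case 1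
    then show ?thesis by (simp add: zero)
  next
    case 2
    have "(\<Sum>i=k..<k+n. ?w i) = ?w k + (\<Sum>i=k+1..<k+n. ?w i)"
      using 2 by (subst sum.atLeast_Suc_lessThan) auto
    moreover have "?w k = \<bar>a k 1\<bar> + \<bar>c\<bar>" using 2 by auto
    moreover have "real (n - 1) * c = real n * c - c" using 2 by (simp add: algebra_simps of_nat_diff)
    ultimately show ?thesis using split[of 1] 2 by linarith
  next
    case 3
    then obtain m where m: "m \<in> {1..N}" "a k m \<le> real m * c" using good by blast
    have "(\<Sum>i=k+m..<k+n. ?w i) \<le> (\<Sum>i=k..<k+n. ?w i)"
      by (rule sum_mono2) auto
    moreover have "real (n - m) * c = real n * c - real m * c" 
      using m 3 by (simp add: algebra_simps of_nat_diff)
    moreover have "a k n \<le> a k m + (real (n - m) * c + (\<Sum>i=k+m..<k+n. ?w i))"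
      using split[of m] m 3 by simp
    ultimately show ?thesis using m by linarith
  qed
qed

context ergodic_map begin

text \<open>Suppose the lower limit were at most \<open>c < L\<close> with positive probability. This event contains its
  preimage, as passing from \<open>T x\<close> to \<open>x\<close> costs only the fixed amount \<open>f 1 x\<close>, so it has
  probability one by ergodicity. Then almost every point is good for a slightly larger slope once
  \<open>N\<close> is large, and integrating the greedy bound over a long orbit segment makes the mean of \<open>f K\<close>
  smaller than \<open>K L\<close>.\<close>

theorem liminf_ge_of_subadditive:
  assumes f: "subadditive f" and lower: "\<And>n. real n * L \<le> (\<integral>x. f n x \<partial>M)"
  shows "AE x in M. ereal L \<le> liminf (\<lambda>n. ereal (f n x / real n))"
proof -
  have [measurable]: "f n \<in> borel_measurable M" for n 
    using f unfolding subadditive_def by (auto intro: borel_measurable_integrable)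
  have int: "integrable M (f n)" for n using f by (auto simp: subadditive_def)
  define sub_at where "sub_at x \<longleftrightarrow> f 0 x = 0 \<and> (\<forall>m n. f (m + n) x \<le> f m x + f n ((T ^^ m) x))" for x
  have AE_sub: "AE x in M. sub_at x" using f by (simp add: subadditive_def sub_at_def)
  define A where "A c = {x \<in> space M. liminf (\<lambda>n. ereal (f n x / real n)) \<le> ereal c}" for c
  have A_sets [measurable]: "A c \<in> sets M" for c unfolding A_def by measurable
  have not_one: "prob (A c) \<noteq> 1" if "c < L" for c
  proof
    assume one: "prob (A c) = 1"
    \<comment> \<open>three errors of size \<open>e\<close> have to fit below \<open>L - c\<close>: the enlarged slope, bad times, the end\<close>
    define e where "e = (L - c) / 4"
    have e: "e > 0" using that by (simp add: e_def)
    define d where "d = c + e"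
    define E where "E N = {x \<in> space M. \<exists>n\<in>{1..N}. f n x \<le> real n * d}" for N :: nat
    have E_sets [measurable]: "E N \<in> sets M" for N unfolding E_def by measurable
    define \<psi> where "\<psi> x = \<bar>f 1 x\<bar> + \<bar>d\<bar>" for x
    have [measurable]: "\<psi> \<in> borel_measurable M" unfolding \<psi>_def by measurable
    have int\<psi>: "integrable M \<psi>" unfolding \<psi>_def using int by auto
    have \<psi>_nonneg: "\<psi> x \<ge> 0" for x by (simp add: \<psi>_def)
    have AE_A: "AE x in M. x \<in> A c" using one by (simp add: prob_eq_1)
    have "(\<lambda>N. \<integral>x. \<psi> x * indicator (- E N) x \<partial>M) \<longlonglongrightarrow> (\<integral>x. 0 \<partial>M)"
    proof (rule integral_dominated_convergence[where w = \<psi>])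
      show "AE x in M. (\<lambda>N. \<psi> x * indicator (- E N) x) \<longlonglongrightarrow> 0"
        using AE_A
      proof eventually_elim
        case (elim x)
        then obtain n where n: "n \<ge> 1" "f n x / real n < d"
          using liminf_le_frequently[of "\<lambda>n. f n x / real n" c d 1] e by (auto simp: A_def d_def)
        then have "f n x \<le> real n * d" by (simp add: field_simps)
        then have "eventually (\<lambda>N. \<psi> x * indicator (- E N) x = 0) sequentially"
          using elim n unfolding eventually_sequentially
          by (intro exI[of _ n]) (auto simp: E_def A_def indicator_def intro!: bexI[of _ n])
        then show ?case by (rule tendsto_eventually)
      qed
    qed (auto simp: int\<psi> indicator_def \<psi>_nonneg)
    then have "eventually (\<lambda>N. (\<integral>x. \<psi> x * indicator (- E N) x \<partial>M) < e) sequentially"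
      using e by (auto intro: order_tendstoD)
    then obtain N where N: "(\<integral>x. \<psi> x * indicator (- E N) x \<partial>M) < e"
      by (auto simp: eventually_sequentially)
    \<comment> \<open>\<open>K\<close> is so long that the cost of the last \<open>N\<close> steps averages out\<close>
    define K where "K = nat \<lceil>real N * (\<integral>x. \<psi> x \<partial>M) / e\<rceil> + N + 1"
    have K: "real N * (\<integral>x. \<psi> x \<partial>M) \<le> real K * e" "N \<le> K" "K \<ge> 1"
    proof -
      have "real N * (\<integral>x. \<psi> x \<partial>M) / e \<le> real K" unfolding K_def by linarith
      then show "real N * (\<integral>x. \<psi> x \<partial>M) \<le> real K * e" using e by (simp add: field_simps)
    qed (auto simp: K_def)
    define w where "w x = \<psi> x * indicator (- E N) x" for x
    have w_int: "integrable M w"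
      unfolding w_def
      by (rule Bochner_Integration.integrable_bound[OF int\<psi>]) (auto simp: indicator_def)
    have "AE x in M. f K x \<le> real K * d + (\<Sum>i<K. w ((T ^^ i) x)) + (\<Sum>i=K-N..<K. \<psi> ((T ^^ i) x))"
      using AE_orbit[OF AE_sub] AE_orbit[OF AE_space]
    proof eventually_elim
      case (elim x)
      let ?B = "{i. (T ^^ i) x \<notin> E N}"
      have sub: "f (m + n) ((T ^^ k) x) \<le> f m ((T ^^ k) x) + f n ((T ^^ (k + m)) x)" for k m n
      proof -
        have "(T ^^ (k + m)) x = (T ^^ m) ((T ^^ k) x)"
          by (subst add.commute) (simp only: funpow_add comp_apply)
        moreover have "sub_at ((T ^^ k) x)" using elim(1) by blast
        ultimately show ?thesis unfolding sub_at_def by presburger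
      qed
      have zero: "f 0 ((T ^^ k) x) = 0" for k
        using elim(1) unfolding sub_at_def by blast
      have good: "\<exists>n\<in>{1..N}. f n ((T ^^ k) x) \<le> real n * d" if "k \<notin> ?B" for k
        using that unfolding E_def by blast
      have "f K ((T ^^ 0) x) \<le> real K * d + 
          (\<Sum>i=0..<0+K. if i \<in> ?B \<or> 0 + K < i + N then \<bar>f 1 ((T ^^ i) x)\<bar> + \<bar>d\<bar> else 0)"
        by (rule orbit_greedy_bound[of "\<lambda>k n. f n ((T ^^ k) x)" ?B N d 0 K]) (rule sub zero good, assumption?)+
      then have "f K x \<le> real K * d + 
          (\<Sum>i<K. if i \<in> ?B \<or> K < i + N then \<psi> ((T ^^ i) x) else 0)"
        unfolding \<psi>_def by (simp only: funpow_0 add_0 atLeast0LessThan)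
      also have "(\<Sum>i<K. if i \<in> ?B \<or> K < i + N then \<psi> ((T ^^ i) x) else 0)
         \<le> (\<Sum>i<K. w ((T ^^ i) x) + (if K - N \<le> i then \<psi> ((T ^^ i) x) else 0))"
        by (rule sum_mono) (auto simp: w_def indicator_def \<psi>_nonneg)
      also have "\<dots> = (\<Sum>i<K. w ((T ^^ i) x)) + (\<Sum>i\<in>{i\<in>{..<K}. K - N \<le> i}. \<psi> ((T ^^ i) x))"
        by (simp only: sum.distrib sum.inter_filter finite_lessThan)
      also have "{i\<in>{..<K}. K - N \<le> i} = {K-N..<K}" by auto
      finally show ?case by (simp only: add.assoc)
    qed
    moreover have i1: "integrable M (\<lambda>x. w ((T ^^ i) x))" for i by (rule integrable_iterate[OF w_int])
    moreover have i2: "integrable M (\<lambda>x. \<psi> ((T ^^ i) x))" for i by (rule integrable_iterate[OF int\<psi>])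
    ultimately have "(\<integral>x. f K x \<partial>M) \<le> (\<integral>x. real K * d + (\<Sum>i<K. w ((T ^^ i) x)) + (\<Sum>i=K-N..<K. \<psi> ((T ^^ i) x)) \<partial>M)"
      by (intro integral_mono_AE int) auto
    also have "\<dots> = real K * d + (\<Sum>i<K. \<integral>x. w ((T ^^ i) x) \<partial>M) + (\<Sum>i=K-N..<K. \<integral>x. \<psi> ((T ^^ i) x) \<partial>M)"
      using i1 i2 by (simp add: prob_space)
    also have "\<dots> = real K * d + real K * (\<integral>x. w x \<partial>M) + real N * (\<integral>x. \<psi> x \<partial>M)"
      using K by (simp add: integral_iterate[OF w_int] integral_iterate[OF int\<psi>])
    also have "\<dots> \<le> real K * d + real K * e + real K * e"
    proof -
      have "real K * (\<integral>x. w x \<partial>M) \<le> real K * e"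
        using N unfolding w_def by (intro mult_left_mono) auto
      then show ?thesis using K(1) by linarith
    qed
    finally have "real K * L \<le> real K * (d + e + e)"
      using lower[of K] by (simp add: algebra_simps)
    then have "L \<le> d + e + e" using K by simp
    moreover have "4 * e = L - c" by (simp add: e_def)
    ultimately show False using e unfolding d_def by linarith
  qed
  have zero: "prob (A c) = 0" if "c < L" for c
  proof -
    have "AE x in M. T x \<in> A c \<longrightarrow> x \<in> A c"
      using AE_sub AE_space
    proof eventually_elim
      case (elim x)
      show ?case
      proof
        assume Tx: "T x \<in> A c"
        have "liminf (\<lambda>n. ereal (f n x / real n)) \<le> ereal c"
        proof (rule ereal_le_epsilon2)
          fix e :: real assume e: "e > 0"
          show "liminf (\<lambda>n. ereal (f n x / real n)) \<le> ereal c + ereal e"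
          proof (rule ccontr)
            assume "\<not> ?thesis"
            then have "ereal (c + e) < liminf (\<lambda>n. ereal (f n x / real n))" by simp
            then have "eventually (\<lambda>n. ereal (c + e) < ereal (f n x / real n)) sequentially"
              by (rule less_LiminfD)
            then obtain N where N: "\<And>n. n \<ge> N \<Longrightarrow> c + e < f n x / real n" 
              by (auto simp: eventually_sequentially)
            \<comment> \<open>from \<open>N'\<close> on, half of the slack \<open>e\<close> per step outweighs the cost of the first step\<close>
            define N' where "N' = N + 1 + nat \<lceil>2 * (\<bar>f 1 x\<bar> + \<bar>c\<bar> + e) / e\<rceil>"
            obtain n where n: "n \<ge> N'" "f n (T x) / real n < c + e / 2"
              using Tx e liminf_le_frequently[of "\<lambda>n. f n (T x) / real n" c "c + e/2" N'] by (auto simp: A_def)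
            have "2 * (\<bar>f 1 x\<bar> + \<bar>c\<bar> + e) / e \<le> real n" using n unfolding N'_def by linarith
            then have big: "2 * (\<bar>f 1 x\<bar> + \<bar>c\<bar> + e) \<le> real n * e" using e by (simp add: field_simps)
            have n1: "n \<ge> 1" "n \<ge> N" using n by (auto simp: N'_def)
            have "f (1 + n) x \<le> f 1 x + f n ((T ^^ 1) x)" using elim(1) unfolding sub_at_def by blast
            then have "f (1 + n) x \<le> f 1 x + f n (T x)" by (simp only: One_nat_def funpow.simps comp_id)
            moreover have "f n (T x) \<le> real n * (c + e / 2)" using n n1 by (simp add: field_simps)
            moreover have "real (1 + n) * (c + e) < f (1 + n) x" using N[of "1 + n"] n1 by (simp add: field_simps)
            moreover have "real (1 + n) * (c + e) = real n * (c + e / 2) + (real n * e) / 2 + c + e" 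
              by (simp add: algebra_simps)
            ultimately have "(real n * e) / 2 + c + e < f 1 x" by argo
            then show False using big e by argo
          qed
        qed
        then show "x \<in> A c" using elim by (simp add: A_def)
      qed
    qed
    then show ?thesis using zero_one[OF A_sets] not_one[OF that] by auto
  qed
  have "AE x in M. \<forall>k::nat. x \<notin> A (L - 1 / real (Suc k))"
    using zero by (auto simp: AE_all_countable prob_eq_0)
  with AE_space show ?thesis
  proof eventually_elim
    case (elim x)
    show ?case
    proof (rule ccontr)
      assume "\<not> ?thesis"
      then have "liminf (\<lambda>n. ereal (f n x / real n)) < ereal L" by simp
      then obtain r where r: "liminf (\<lambda>n. ereal (f n x / real n)) < ereal r" "ereal r < ereal L"
        using ereal_dense2 by blast
      obtain k where "1 / real (Suc k) < L - r" using r(2) reals_Archimedean[of "L - r"] 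
        by (auto simp: inverse_eq_divide)
      then have "liminf (\<lambda>n. ereal (f n x / real n)) \<le> ereal (L - 1 / real (Suc k))"
        using r(1) by (intro order.trans[OF less_imp_le[OF r(1)]]) simp
      then show False using elim by (auto simp: A_def)
    qed
  qed
qed

corollary eventually_gt_of_subadditive:
  assumes f: "subadditive f" and lower: "\<And>n. real n * L \<le> (\<integral>x. f n x \<partial>M)"
  shows "AE x in M. \<forall>e>0. eventually (\<lambda>n. L - e < f n x / real n) sequentially"
  using liminf_ge_of_subadditive[OF assms]
proof eventually_elim
  case (elim x)
  show ?case
  proof (intro allI impI)
    fix e :: real assume "e > 0"
    then have "ereal (L - e) < liminf (\<lambda>n. ereal (f n x / real n))"
      by (intro less_le_trans[OF _ elim]) simp
    from less_LiminfD[OF this] show "eventually (\<lambda>n. L - e < f n x / real n) sequentially" by simp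
  qed
qed

text \<open>Additive processes are subadditive, and so are their negatives; the lower bound for both gives
  convergence.\<close>

theorem birkhoff:
  fixes h :: "'a \<Rightarrow> real"
  assumes h: "integrable M h"
  shows "AE x in M. (\<lambda>n. (\<Sum>k<n. h ((T ^^ k) x)) / real n) \<longlonglongrightarrow> (\<integral>x. h x \<partial>M)"
proof -
  have sub: "subadditive (\<lambda>n x. \<Sum>k<n. g ((T ^^ k) x))" if "integrable M g" for g :: "'a \<Rightarrow> real"
    unfolding subadditive_def
  proof (intro conjI allI AE_I2)
    show "integrable M (\<lambda>x. \<Sum>k<n. g ((T ^^ k) x))" for n
      by (intro Bochner_Integration.integrable_sum integrable_iterate that)
    show "(\<Sum>k<m + n. g ((T ^^ k) x)) \<le> (\<Sum>k<m. g ((T ^^ k) x)) + (\<Sum>k<n. g ((T ^^ k) ((T ^^ m) x)))" for m n x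
    proof -
      have "(\<Sum>k<n. g ((T ^^ k) ((T ^^ m) x))) = (\<Sum>k<n. g ((T ^^ (m + k)) x))"
        by (simp add: funpow_add add.commute[of m])
      also have "\<dots> = (\<Sum>k=m..<m+n. g ((T ^^ k) x))"
        using sum.shift_bounds_nat_ivl[of "\<lambda>k. g ((T ^^ k) x)" 0 m n] 
        by (simp add: atLeast0LessThan add.commute)
      finally show ?thesis 
        using sum.atLeastLessThan_concat[of 0 m "m + n" "\<lambda>k. g ((T ^^ k) x)"] by (simp add: atLeast0LessThan)
    qed
  qed simp
  have int: "(\<integral>x. (\<Sum>k<n. g ((T ^^ k) x)) \<partial>M) = real n * (\<integral>x. g x \<partial>M)" if "integrable M g" for n and g :: "'a \<Rightarrow> real"
    using integrable_iterate[OF that] by (simp add: integral_iterate[OF that])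
  have h': "integrable M (\<lambda>x. - h x)" using h by simp
  have "AE x in M. \<forall>e>0. eventually (\<lambda>n. (\<integral>x. h x \<partial>M) - e < (\<Sum>k<n. h ((T ^^ k) x)) / real n) sequentially"
    by (rule eventually_gt_of_subadditive[OF sub[OF h]]) (simp add: int[OF h])
  moreover have "AE x in M. \<forall>e>0. eventually (\<lambda>n. (\<integral>x. - h x \<partial>M) - e < (\<Sum>k<n. - h ((T ^^ k) x)) / real n) sequentially"
    by (rule eventually_gt_of_subadditive[OF sub[OF h']]) (simp only: int[OF h'] order.refl)
  ultimately show ?thesis
  proof eventually_elim
    case (elim x)
    show ?case
    proof (rule order_tendstoI)
      fix a assume "a < (\<integral>x. h x \<partial>M)"
      then show "eventually (\<lambda>n. a < (\<Sum>k<n. h ((T ^^ k) x)) / real n) sequentially"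
        using elim(1)[rule_format, of "(\<integral>x. h x \<partial>M) - a"] by simp
    next
      fix a assume "(\<integral>x. h x \<partial>M) < a"
      then show "eventually (\<lambda>n. (\<Sum>k<n. h ((T ^^ k) x)) / real n < a) sequentially"
        using elim(2)[rule_format, of "a - (\<integral>x. h x \<partial>M)"] by (simp add: sum_negf)
    qed
  qed
qed

end

text \<open>For the upper bound, an orbit is cut into blocks of a fixed length \<open>m\<close>, so the ergodic theorem
  is needed for the powers of the map.\<close>

locale totally_ergodic_map = measure_preserving_map +
  assumes power_zero_one: "1 \<le> m \<Longrightarrow> A \<in> sets M \<Longrightarrow> AE x in M. (T ^^ m) x \<in> A \<longrightarrow> x \<in> A \<Longrightarrow> prob A = 0 \<or> prob A = 1"
begin

lemma ergodic_power: "1 \<le> m \<Longrightarrow> ergodic_map M (T ^^ m)"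
  using power_zero_one iterate_preserving by unfold_locales auto

sublocale ergodic_map M T
  using ergodic_power[of 1] by simp

end

lemma filterlim_div_const:
  assumes "m \<ge> (1::nat)"
  shows "filterlim (\<lambda>n. n div m) sequentially sequentially"
  unfolding filterlim_at_top
proof
  fix Z
  show "eventually (\<lambda>n. Z \<le> n div m) sequentially"
    using eventually_ge_at_top[of "Z * m"]
    by eventually_elim (use assms in \<open>simp add: less_eq_div_iff_mult_less_eq\<close>)
qed

lemma tendsto_div_const_over_self:
  assumes "m \<ge> (1::nat)"
  shows "(\<lambda>n. real (n div m) / real n) \<longlonglongrightarrow> 1 / real m"
proof -
  have "(\<lambda>n. real (n mod m) / real n) \<longlonglongrightarrow> 0"
  proof (rule tendsto_sandwich[of "\<lambda>_. 0" _ _ "\<lambda>n. real m / real n"])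
    show "eventually (\<lambda>n. real (n mod m) / real n \<le> real m / real n) sequentially"
      using assms by (intro always_eventually allI divide_right_mono) (auto simp: less_imp_le)
    show "(\<lambda>n. real m / real n) \<longlonglongrightarrow> 0" by (rule lim_const_over_n)
  qed auto
  then have "(\<lambda>n. (1 - real (n mod m) / real n) / real m) \<longlonglongrightarrow> (1 - 0) / real m"
    by (intro tendsto_intros) (use assms in auto)
  moreover have "eventually (\<lambda>n. (1 - real (n mod m) / real n) / real m = real (n div m) / real n) sequentially"
    using eventually_gt_at_top[of 0]
  proof eventually_elim
    case (elim n)
    have "real n = real (n div m) * real m + real (n mod m)"
      by (metis div_mult_mod_eq of_nat_add of_nat_mult)
    then have "1 - real (n mod m) / real n = real (n div m) * real m / real n"
      using elim by (simp add: field_simps)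
    then show ?case using assms by simp
  qed
  ultimately show ?thesis by (simp add: tendsto_cong)
qed

context totally_ergodic_map begin

text \<open>Split time \<open>n\<close> into \<open>n div m\<close> blocks of length \<open>m\<close> and a rest. The blocks obey the ergodic theorem
  for the \<open>m\<close>-th power of the map. The rest is bounded by a difference of two partial sums of
  \<open>\<bar>f 1\<bar>\<close> whose averages have the same limit.\<close>

lemma eventually_lt_of_subadditive:
  assumes f: "subadditive f" and m: "m \<ge> 1"
  shows "AE x in M. \<forall>e>0. eventually (\<lambda>n. f n x / real n < (\<integral>x. f m x \<partial>M) / real m + e) sequentially"
proof -
  interpret power: ergodic_map M "T ^^ m" by (rule ergodic_power[OF m])
  have int: "integrable M (f n)" for n using f by (auto simp: subadditive_def)
  define sub_at where "sub_at x \<longleftrightarrow> f 0 x = 0 \<and> (\<forall>m n. f (m + n) x \<le> f m x + f n ((T ^^ m) x))" for x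
  have AE_sub: "AE x in M. sub_at x" using f by (simp add: subadditive_def sub_at_def)
  define I where "I = (\<integral>x. f m x \<partial>M)"
  define \<beta> where "\<beta> = (\<integral>x. \<bar>f 1 x\<bar> \<partial>M)"
  have "AE x in M. (\<lambda>n. (\<Sum>k<n. \<bar>f 1 ((T ^^ k) x)\<bar>) / real n) \<longlonglongrightarrow> \<beta>"
    unfolding \<beta>_def by (rule birkhoff) (use int in auto)
  moreover have "AE x in M. (\<lambda>n. (\<Sum>k<n. f m (((T ^^ m) ^^ k) x)) / real n) \<longlonglongrightarrow> I"
    unfolding I_def by (rule power.birkhoff[OF int])
  ultimately show ?thesis
    using AE_orbit[OF AE_sub]
  proof eventually_elim
    case (elim x)
    define A where "A n = (\<Sum>k<n. f m (((T ^^ m) ^^ k) x))" for n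
    define B where "B n = (\<Sum>k<n. \<bar>f 1 ((T ^^ k) x)\<bar>)" for n
    have sub: "f (i + j) ((T ^^ k) x) \<le> f i ((T ^^ k) x) + f j ((T ^^ (k + i)) x)" for i j k
    proof -
      have "(T ^^ (k + i)) x = (T ^^ i) ((T ^^ k) x)"
        by (subst add.commute) (simp only: funpow_add comp_apply)
      moreover have "sub_at ((T ^^ k) x)" using elim(3) by blast
      ultimately show ?thesis unfolding sub_at_def by presburger
    qed
    have zero: "f 0 ((T ^^ k) x) = 0" for k using elim(3) unfolding sub_at_def by blast
    have blocks: "f (m * q) x \<le> A q" for q
    proof (induction q)
      case 0 then show ?case using zero[of 0] by (simp add: A_def)
    next
      case (Suc q)
      have "f (m * q + m) ((T ^^ 0) x) \<le> f (m * q) ((T ^^ 0) x) + f m ((T ^^ (0 + m * q)) x)" by (rule sub)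
      then show ?case using Suc by (simp add: A_def funpow_mult add.commute)
    qed
    have rest: "f r ((T ^^ p) x) \<le> B (p + r) - B p" for p r
    proof (induction r)
      case 0 then show ?case using zero[of p] by simp
    next
      case (Suc r)
      have "f (r + 1) ((T ^^ p) x) \<le> f r ((T ^^ p) x) + f 1 ((T ^^ (p + r)) x)" by (rule sub)
      moreover have "B (p + Suc r) = B (p + r) + \<bar>f 1 ((T ^^ (p + r)) x)\<bar>" by (simp add: B_def)
      moreover have "f 1 ((T ^^ (p + r)) x) \<le> \<bar>f 1 ((T ^^ (p + r)) x)\<bar>" by (rule abs_ge_self)
      ultimately show ?case using Suc unfolding Suc_eq_plus1[of r] by linarith
    qed
    define u where "u n = A (n div m) / real (n div m) * (real (n div m) / real n) + 
        (B n / real n - B (m * (n div m)) / real (m * (n div m)) * (real m * (real (n div m) / real n)))" for n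
    have bound: "f n x / real n \<le> u n" if "n \<ge> m" for n
    proof -
      define q where "q = n div m"
      have q: "q \<ge> 1" using that m by (simp add: q_def div_greater_zero_iff Suc_le_eq)
      have n: "n = m * q + n mod m" by (simp add: q_def)
      have "f (m * q + n mod m) ((T ^^ 0) x) \<le> f (m * q) ((T ^^ 0) x) + f (n mod m) ((T ^^ (0 + m * q)) x)" by (rule sub)
      then have "f n x \<le> f (m * q) x + f (n mod m) ((T ^^ (m * q)) x)" by (simp only: n[symmetric] funpow_0 add_0)
      also have "\<dots> \<le> A q + (B n - B (m * q))"
        using blocks[of q] rest[of "n mod m" "m * q"] unfolding n[symmetric] by linarith
      finally have "f n x / real n \<le> (A q + (B n - B (m * q))) / real n" by (rule divide_right_mono) simp
      also have "\<dots> = u n" using q m that unfolding u_def q_def[symmetric] by (simp add: field_simps)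
      finally show ?thesis .
    qed
    have dm: "filterlim (\<lambda>n. n div m) sequentially sequentially" by (rule filterlim_div_const[OF m])
    have mdm: "filterlim (\<lambda>n. m * (n div m)) sequentially sequentially"
      by (rule filterlim_compose[OF mult_nat_left_at_top dm]) (use m in simp)
    have "u \<longlonglongrightarrow> I * (1 / real m) + (\<beta> - \<beta> * (real m * (1 / real m)))"
      unfolding u_def
      by (intro tendsto_intros tendsto_div_const_over_self[OF m]
          filterlim_compose[OF elim(2)[folded A_def] dm] elim(1)[folded B_def]
          filterlim_compose[OF elim(1)[folded B_def] mdm])
    then have lim: "u \<longlonglongrightarrow> I / real m" using m by simp
    show ?case
    proof (intro allI impI)
      fix e :: real assume "e > 0"
      then have "eventually (\<lambda>n. u n < I / real m + e) sequentially"
        by (intro order_tendstoD(2)[OF lim]) simp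
      then show "eventually (\<lambda>n. f n x / real n < (\<integral>x. f m x \<partial>M) / real m + e) sequentially"
        using eventually_ge_at_top[of m]
      proof eventually_elim
        case (elim n)
        then show ?case using bound[of n] by (simp add: I_def)
      qed
    qed
  qed
qed

text \<open>Kingman's theorem in the totally ergodic case.\<close>

theorem subadditive_ergodic:
  assumes f: "subadditive f" and bdd: "bdd_below ((\<lambda>n. (\<integral>x. f n x \<partial>M) / real n) ` {1..})"
  shows "AE x in M. (\<lambda>n. f n x / real n) \<longlonglongrightarrow> (INF n\<in>{1..}. (\<integral>x. f n x \<partial>M) / real n)"
proof -
  define L where "L = (INF n\<in>{1..}. (\<integral>x. f n x \<partial>M) / real n)"
  have "real n * L \<le> (\<integral>x. f n x \<partial>M)" for n
  proof (cases "n = 0")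
    case True
    have "(\<integral>x. f 0 x \<partial>M) = (\<integral>x. 0 \<partial>M)" 
      using f unfolding subadditive_def by (intro integral_cong_AE) auto
    then show ?thesis using True by simp
  next
    case False
    then have "L \<le> (\<integral>x. f n x \<partial>M) / real n" unfolding L_def by (intro cINF_lower[OF bdd]) auto
    then show ?thesis using False by (simp add: field_simps)
  qed
  then have "AE x in M. \<forall>e>0. eventually (\<lambda>n. L - e < f n x / real n) sequentially"
    by (rule eventually_gt_of_subadditive[OF f])
  moreover have "AE x in M. \<forall>m. m \<ge> 1 \<longrightarrow> (\<forall>e>0. eventually (\<lambda>n. f n x / real n < (\<integral>x. f m x \<partial>M) / real m + e) sequentially)"
    unfolding AE_all_countable using eventually_lt_of_subadditive[OF f] by auto
  ultimately show ?thesis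
    unfolding L_def[symmetric]
  proof eventually_elim
    case (elim x)
    show ?case
    proof (rule order_tendstoI)
      fix a assume "a < L"
      then show "eventually (\<lambda>n. a < f n x / real n) sequentially"
        using elim(1)[rule_format, of "L - a"] by simp
    next
      fix a assume "L < a"
      then obtain m where m: "m \<ge> 1" "(\<integral>x. f m x \<partial>M) / real m < a" 
        unfolding L_def by (subst (asm) cINF_less_iff[OF _ bdd]) auto
      then show "eventually (\<lambda>n. f n x / real n < a) sequentially"
        using elim(2)[rule_format, of m "a - (\<integral>x. f m x \<partial>M) / real m"] by simp
    qed
  qed
qed

end

section \<open>The Bernoulli shift\<close>

text \<open>Both the invariance of the product measure under the shift and the reversal of a random product
  are instances of reading independent coordinates in another order.\<close>

lemma distr_PiM_relabel:
  fixes M N :: "'a measure" and \<sigma> :: "nat \<Rightarrow> nat"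
  assumes M: "prob_space M" and N: "N = distr M N' f" and f: "f \<in> measurable M N'" and \<sigma>: "inj \<sigma>"
  shows "distr (PiM UNIV (\<lambda>_. M)) (PiM UNIV (\<lambda>_. N)) (\<lambda>\<omega> i. f (\<omega> (\<sigma> i))) = PiM UNIV (\<lambda>_. N)"
proof -
  interpret M: prob_space M by fact
  interpret N: prob_space N unfolding N by (rule M.prob_space_distr[OF f])
  interpret PM: sequence_space M by unfold_locales
  interpret PN: sequence_space N by unfold_locales
  have f' [measurable]: "f \<in> measurable M N" using f by (simp add: N)
  have map [measurable]: "(\<lambda>\<omega> i. f (\<omega> (\<sigma> i))) \<in> measurable PM.S PN.S"
    by (rule measurable_PiM_single') (auto simp: space_PiM PiE_iff dest: measurable_space[OF f'])
  show ?thesis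
  proof (rule PN.PiM_eq)
    fix J :: "nat set" and E assume J: "finite J" "\<And>j. j \<in> J \<Longrightarrow> E j \<in> sets N"
    have [simp]: "inj_on \<sigma> J" using \<sigma> by (rule inj_on_subset) simp
    define E' where "E' i = f -` E (inv \<sigma> i) \<inter> space M" for i
    have inv: "inv \<sigma> (\<sigma> j) = j" for j using \<sigma> by simp
    have "emeasure (distr PM.S PN.S (\<lambda>\<omega> i. f (\<omega> (\<sigma> i)))) (prod_emb UNIV (\<lambda>_. N) J (PiE J E))
      = emeasure PM.S (prod_emb UNIV (\<lambda>_. M) (\<sigma> ` J) (PiE (\<sigma> ` J) E'))"
      using J measurable_space[OF f']
      by (subst emeasure_distr[OF map sets_PiM_I]) (auto intro!: arg_cong[where f = "emeasure PM.S"]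
          simp: prod_emb_def space_PiM PiE_iff E'_def inv)
    also have "\<dots> = (\<Prod>i\<in>\<sigma> ` J. emeasure M (E' i))"
      using J by (intro PM.emeasure_PiM_emb) (auto simp: E'_def inv)
    also have "\<dots> = (\<Prod>j\<in>J. emeasure N (E j))"
      using J f by (subst prod.reindex) (auto simp: E'_def inv N emeasure_distr intro!: prod.cong)
    finally show "emeasure (distr PM.S PN.S (\<lambda>\<omega> i. f (\<omega> (\<sigma> i)))) (prod_emb UNIV (\<lambda>_. N) J (PiE J E)) = (\<Prod>j\<in>J. emeasure N (E j))" .
  qed simp
qed

definition shift :: "(nat \<Rightarrow> 'a) \<Rightarrow> nat \<Rightarrow> 'a" where "shift \<omega> i = \<omega> (Suc i)"

lemma shift_iterate: "(shift ^^ m) \<omega> = (\<lambda>i. \<omega> (i + m))"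
  by (induction m) (auto simp: shift_def fun_eq_iff)

text \<open>If \<open>A\<close> contains its preimage under a power of the shift, then \<open>A\<close> agrees almost everywhere with
  the upper limit \<open>R\<close> of its iterated preimages. These depend only on later and later coordinates,
  so \<open>R\<close> is a tail event and Kolmogorov's law applies.\<close>

proposition bernoulli_shift_totally_ergodic:
  assumes "prob_space \<mu>"
  shows "totally_ergodic_map (PiM UNIV (\<lambda>_. \<mu>)) shift"
proof -
  interpret \<mu>: prob_space \<mu> by fact
  interpret P: sequence_space \<mu> by unfold_locales
  have shift_eq: "shift = (\<lambda>\<omega> i. id (\<omega> (Suc i)))" by (simp add: shift_def fun_eq_iff)
  interpret measure_preserving_map P.S shift
  proof
    show "shift \<in> measurable P.S P.S"
      unfolding shift_def by (rule measurable_PiM_single') (auto simp: space_PiM PiE_iff)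
    show "distr P.S P.S shift = P.S"
      unfolding shift_eq by (rule distr_PiM_relabel[OF assms, where N' = \<mu>]) (auto simp: distr_id2)
  qed
  show ?thesis
  proof
    fix m :: nat and A assume m: "1 \<le> m" and A [measurable]: "A \<in> sets P.S" 
      and sub: "AE x in P.S. (shift ^^ m) x \<in> A \<longrightarrow> x \<in> A"
    define F where "F i = sigma_sets (space P.S) {(\<lambda>x. x i) -` B \<inter> space P.S | B. B \<in> sets \<mu>}" for i :: nat
    define R where "R = (\<Inter>n. \<Union>k\<in>{n..}. (shift ^^ (m * k)) -` A \<inter> space P.S)"
    have F_sub: "F i \<subseteq> Pow (space P.S)" for i
      unfolding F_def by (rule sigma_sets_into_sp[THEN subsetI[OF PowI]]) auto
    have indep: "P.indep_sets F UNIV"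
    proof -
      have "P.indep_vars (\<lambda>_. \<mu>) (\<lambda>i x. x i) UNIV"
        by (subst P.indep_vars_iff_distr_eq_PiM) 
           (auto simp: distr_id2 restrict_UNIV distr_PiM_component[OF \<mu>.prob_space_axioms])
      then show ?thesis unfolding P.indep_vars_def F_def by simp
    qed
    have "R \<in> P.tail_events F"
      unfolding P.tail_events_def
    proof
      fix n
      define N where "N = sigma (space P.S) (\<Union> (F ` {n..}))"
      have N_sets: "sets N = sigma_sets (space P.S) (\<Union> (F ` {n..}))" and N_space: "space N = space P.S"
        unfolding N_def using F_sub by (auto intro!: sets_measure_of space_measure_of)
      have coord: "(\<lambda>x. x i) \<in> measurable N \<mu>" if "i \<ge> n" for i
      proof (rule measurableI)
        fix B assume "B \<in> sets \<mu>"
        then have "(\<lambda>x. x i) -` B \<inter> space P.S \<in> F i" unfolding F_def by (intro sigma_sets.Basic) auto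
        then show "(\<lambda>x. x i) -` B \<inter> space N \<in> sets N"
          unfolding N_sets N_space using that by (intro sigma_sets.Basic) auto
      qed (auto simp: N_space space_PiM PiE_iff)
      have shift_N: "shift ^^ p \<in> measurable N P.S" if "p \<ge> n" for p
        unfolding shift_iterate[abs_def]
        by (rule measurable_PiM_single') (use that in \<open>auto intro!: coord simp: N_space space_PiM PiE_iff\<close>)
      have "R = (\<Inter>j\<in>{n..}. \<Union>k\<in>{j..}. (shift ^^ (m * k)) -` A \<inter> space P.S)"
      proof (intro set_eqI iffI)
        fix x assume x: "x \<in> (\<Inter>j\<in>{n..}. \<Union>k\<in>{j..}. (shift ^^ (m * k)) -` A \<inter> space P.S)"
        have "x \<in> (\<Union>k\<in>{j..}. (shift ^^ (m * k)) -` A \<inter> space P.S)" for j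
        proof -
          have "x \<in> (\<Union>k\<in>{max j n..}. (shift ^^ (m * k)) -` A \<inter> space P.S)"
            using x by (simp only: INT_iff) auto
          then show ?thesis by auto
        qed
        then show "x \<in> R" unfolding R_def by blast
      qed (auto simp: R_def)
      also have "\<dots> \<in> sets N"
      proof (intro sets.countable_INT' sets.countable_UN'' image_subsetI)
        fix j k assume jk: "j \<in> {n..}" "k \<in> {j..}"
        then have "m * k \<ge> n" using m by (metis atLeast_iff mult_1 mult_le_mono1 order_trans)
        from measurable_sets[OF shift_N[OF this] A]
        show "(shift ^^ (m * k)) -` A \<inter> space P.S \<in> sets N" by (simp add: N_space)
      qed auto
      finally show "R \<in> sigma_sets (space P.S) (\<Union> (F ` {n..}))" by (simp add: N_sets)
    qed
    moreover have "sigma_algebra (space P.S) (F i)" for i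
      unfolding F_def by (rule sigma_algebra_sigma_sets) auto
    ultimately have "P.prob R = 0 \<or> P.prob R = 1" using indep by (intro P.kolmogorov_0_1_law)
    moreover have "P.prob R = P.prob A"
    proof (rule antisym)
      have [measurable]: "R \<in> sets P.S" unfolding R_def by measurable
      have "AE x in P.S. x \<in> R \<longrightarrow> x \<in> A"
        using AE_orbit[OF sub]
      proof eventually_elim
        case (elim x)
        have "x \<in> A" if "(shift ^^ (m * k)) x \<in> A" for k
          using that
        proof (induction k)
          case (Suc k)
          have "(shift ^^ m) ((shift ^^ (m * k)) x) = (shift ^^ (m * Suc k)) x"
            by (simp add: funpow_add)
          then show ?case using Suc elim by metis
        qed simp
        then show ?case unfolding R_def by auto
      qed
      then show "P.prob R \<le> P.prob A" by (intro P.finite_measure_mono_AE) auto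
      have "(\<lambda>n. P.prob (\<Union>k\<in>{n..}. (shift ^^ (m * k)) -` A \<inter> space P.S)) \<longlonglongrightarrow> P.prob R"
        unfolding R_def by (intro P.finite_Lim_measure_decseq) (auto simp: decseq_def, meson atLeast_iff order_trans)
      moreover have "P.prob A \<le> P.prob (\<Union>k\<in>{n..}. (shift ^^ (m * k)) -` A \<inter> space P.S)" for n
      proof -
        have "P.prob A = P.prob ((shift ^^ (m * n)) -` A \<inter> space P.S)" by (rule prob_vimage_iterate[OF A, symmetric])
        also have "\<dots> \<le> P.prob (\<Union>k\<in>{n..}. (shift ^^ (m * k)) -` A \<inter> space P.S)"
          by (intro P.finite_measure_mono) auto
        finally show ?thesis .
      qed
      ultimately show "P.prob A \<le> P.prob R" by (intro LIMSEQ_le_const) auto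
    qed
    ultimately show "P.prob A = 0 \<or> P.prob A = 1" by simp
  qed
qed

section \<open>Linear maps and their distortion\<close>

text \<open>Matrices with rational entries are dense. This makes the space of linear maps second countable,
  which is needed twice: composition has to be measurable for the product of the Borel
  \<open>\<sigma>\<close>-algebras, and a measure has to be concentrated on its support.\<close>

lemma blinfun_matrix_approximation:
  fixes f :: "'a::euclidean_space \<Rightarrow>\<^sub>L 'b::euclidean_space"
  assumes "e > 0"
  shows "\<exists>q\<in>PiE Basis (\<lambda>_. PiE Basis (\<lambda>_. \<rat>)). dist (blinfun_of_matrix q) f < e"
proof -
  define d where "d = e / (real DIM('b) * real DIM('a))"
  have d: "d > 0" using assms by (simp add: d_def)
  have "\<forall>i j. \<exists>r. r \<in> \<rat> \<and> \<bar>r - f j \<bullet> i\<bar> < d"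
  proof (intro allI)
    fix i j
    obtain r where "r \<in> \<rat>" "f j \<bullet> i < r" "r < f j \<bullet> i + d"
      using Rats_dense_in_real[of "f j \<bullet> i" "f j \<bullet> i + d"] d by auto
    then show "\<exists>r. r \<in> \<rat> \<and> \<bar>r - f j \<bullet> i\<bar> < d" by (intro exI[of _ r]) auto
  qed
  then obtain r where r: "\<And>i j. r i j \<in> \<rat>" "\<And>i j. \<bar>r i j - f j \<bullet> i\<bar> < d" by metis
  define q where "q = (\<lambda>i\<in>Basis. \<lambda>j\<in>Basis. r i j)"
  have "dist (blinfun_of_matrix q) f = norm (blinfun_of_matrix (q - (\<lambda>i j. f j \<bullet> i)))"
    unfolding dist_norm blinfun_of_matrix_minus[symmetric] blinfun_of_matrix_works ..
  also have "\<dots> \<le> (\<Sum>i\<in>Basis. \<Sum>j\<in>Basis. \<bar>(q - (\<lambda>i j. f j \<bullet> i)) i j\<bar>)"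
    by (rule norm_blinfun_of_matrix)
  also have "\<dots> < (\<Sum>i\<in>(Basis::'b set). \<Sum>j\<in>(Basis::'a set). d)"
    by (intro sum_strict_mono) (auto simp: q_def r)
  also have "\<dots> = e" by (simp add: d_def)
  finally show ?thesis using r by (intro bexI[of _ q]) (auto simp: q_def)
qed

instance blinfun :: (euclidean_space, euclidean_space) second_countable_topology
proof
  define Q :: "('b \<Rightarrow> 'a \<Rightarrow> real) set" where "Q = PiE Basis (\<lambda>_. PiE Basis (\<lambda>_. \<rat>))"
  define B where "B = (\<lambda>(q, n::nat). ball (blinfun_of_matrix q :: 'a \<Rightarrow>\<^sub>L 'b) (inverse (Suc n))) ` (Q \<times> UNIV)"
  have "countable B" unfolding B_def Q_def
    by (intro countable_image countable_SIGMA countable_PiE countable_rat) auto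
  moreover have "topological_basis B"
  proof (rule topological_basisI)
    fix S :: "('a \<Rightarrow>\<^sub>L 'b) set" and f assume S: "open S" "f \<in> S"
    then obtain e where e: "e > 0" "ball f e \<subseteq> S" by (meson open_contains_ball)
    obtain n where n: "inverse (real (Suc n)) < e / 2" using reals_Archimedean[of "e/2"] e by auto
    obtain q where q: "q \<in> Q" "dist (blinfun_of_matrix q) f < inverse (real (Suc n))"
      unfolding Q_def using blinfun_matrix_approximation[of "inverse (real (Suc n))" f] by auto
    have "ball (blinfun_of_matrix q) (inverse (Suc n)) \<subseteq> ball f e"
    proof
      fix g assume "g \<in> ball (blinfun_of_matrix q) (inverse (Suc n))"
      then show "g \<in> ball f e" using q n dist_triangle[of f g "blinfun_of_matrix q"] by (simp add: dist_commute)
    qed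
    then show "\<exists>B'\<in>B. f \<in> B' \<and> B' \<subseteq> S" using q e unfolding B_def by (intro bexI[of _ "ball (blinfun_of_matrix q) (inverse (Suc n))"]) auto
  qed (auto simp: B_def)
  ultimately show "\<exists>B::('a \<Rightarrow>\<^sub>L 'b) set set. countable B \<and> open = generate_topology B"
    by (blast intro: topological_basis_imp_subbasis)
qed

lemma measurable_blinfun_apply [measurable (raw)]:
  fixes f :: "'c \<Rightarrow> ('a::euclidean_space \<Rightarrow>\<^sub>L 'b::euclidean_space)"
  assumes "f \<in> borel_measurable M" "x \<in> borel_measurable M"
  shows "(\<lambda>\<omega>. blinfun_apply (f \<omega>) (x \<omega>)) \<in> borel_measurable M"
  using assms by (rule borel_measurable_continuous_Pair) (intro continuous_intros)

lemma measurable_blinfun_compose [measurable (raw)]: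
  fixes f :: "'d \<Rightarrow> ('b::euclidean_space \<Rightarrow>\<^sub>L 'c::euclidean_space)" and g :: "'d \<Rightarrow> ('a::euclidean_space \<Rightarrow>\<^sub>L 'b)"
  assumes "f \<in> borel_measurable M" "g \<in> borel_measurable M"
  shows "(\<lambda>\<omega>. f \<omega> o\<^sub>L g \<omega>) \<in> borel_measurable M"
  using assms by (rule borel_measurable_continuous_Pair) (intro continuous_intros)

lemma space_GL_borel [simp]: "space GL_borel = GL"
  by (simp add: GL_borel_def space_restrict_space)

lemma measurable_GL_borelI:
  assumes "f \<in> borel_measurable M" "\<And>x. x \<in> space M \<Longrightarrow> f x \<in> GL"
  shows "f \<in> measurable M GL_borel"
  unfolding GL_borel_def using assms by (intro measurable_restrict_space2) auto

lemma borel_measurable_GL_borel: "f \<in> borel_measurable borel \<Longrightarrow> f \<in> borel_measurable GL_borel"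
  unfolding GL_borel_def by (rule measurable_restrict_space1)

lemma measurable_of_GL_borel: "f \<in> measurable M GL_borel \<Longrightarrow> f \<in> borel_measurable M"
  by (rule measurable_compose[where g = "\<lambda>x. x" and N = GL_borel]) 
     (assumption, rule borel_measurable_GL_borel, rule measurable_ident_sets, rule refl)

lemma prob_on_GL_D:
  assumes "prob_on_GL \<mu>"
  shows "prob_space \<mu>" "sets \<mu> = sets GL_borel" "space \<mu> = GL"
  using assms sets_eq_imp_space_eq[of \<mu> GL_borel] by (auto simp: prob_on_GL_def)

lemma GL_inj: "g \<in> GL \<Longrightarrow> blinfun_apply g v = 0 \<longleftrightarrow> v = 0"
  using inj_eq[of "blinfun_apply g" v 0] by (simp add: GL_def bij_def blinfun.zero_right)

lemma GL_compose: "g \<in> GL \<Longrightarrow> h \<in> GL \<Longrightarrow> h o\<^sub>L g \<in> GL"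
  using bij_comp[of "blinfun_apply g" "blinfun_apply h"] by (simp add: GL_def blinfun_compose.rep_eq)

lemma id_GL: "id_blinfun \<in> GL"
  using bij_id by (simp add: GL_def id_def)

lemma linear_blinfun_apply: "linear (blinfun_apply g)"
  by (rule bounded_linear.linear[OF blinfun.bounded_linear_right])

lemma transpose_apply: "blinfun_apply (transpose_blinfun g) = adjoint (blinfun_apply g)"
  unfolding transpose_blinfun_def
  by (rule bounded_linear_Blinfun_apply) (simp add: linear_conv_bounded_linear[symmetric] adjoint_linear linear_blinfun_apply)

lemma inner_transpose: "v \<bullet> blinfun_apply (transpose_blinfun g) w = blinfun_apply g v \<bullet> w"
  by (simp add: transpose_apply adjoint_works linear_blinfun_apply)

lemma transpose_eqI:
  assumes "\<And>v w. v \<bullet> blinfun_apply h w = blinfun_apply g v \<bullet> w"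
  shows "transpose_blinfun g = h"
proof (rule blinfun_eqI)
  fix w
  show "transpose_blinfun g w = h w"
    by (rule vector_eq_ldot[THEN iffD1]) (simp add: inner_transpose assms)
qed

lemma transpose_compose: "transpose_blinfun (h o\<^sub>L g) = transpose_blinfun g o\<^sub>L transpose_blinfun h"
  by (rule transpose_eqI) (simp add: inner_transpose)

lemma transpose_transpose: "transpose_blinfun (transpose_blinfun g) = g"
proof (rule transpose_eqI)
  fix v w
  show "v \<bullet> blinfun_apply g w = blinfun_apply (transpose_blinfun g) v \<bullet> w"
    using inner_transpose[of w g v] by (simp add: inner_commute)
qed

lemma transpose_id: "transpose_blinfun id_blinfun = id_blinfun"
  by (rule transpose_eqI) simp

lemma norm_transpose_apply_le:
  assumes "\<And>v. norm (blinfun_apply g v) \<le> c * norm v"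
  shows "norm (blinfun_apply (transpose_blinfun g) w) \<le> c * norm w"
proof (cases "transpose_blinfun g w = 0")
  case True
  have "0 \<le> norm (blinfun_apply g (SOME i. i \<in> Basis))" by simp
  also have "\<dots> \<le> c * 1" using assms[of "SOME i. i \<in> Basis"] by simp
  finally show ?thesis using True by simp
next
  case False
  let ?u = "transpose_blinfun g w"
  have "norm ?u * norm ?u = blinfun_apply g ?u \<bullet> w"
    by (metis inner_transpose power2_eq_square power2_norm_eq_inner)
  also have "\<dots> \<le> norm (blinfun_apply g ?u) * norm w" by (rule norm_cauchy_schwarz)
  also have "\<dots> \<le> c * norm ?u * norm w" by (intro mult_right_mono assms) simp
  finally show ?thesis using False by (simp add: mult.commute mult.left_commute)
qed

lemma transpose_GL: "g \<in> GL \<Longrightarrow> transpose_blinfun g \<in> GL"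
  by (simp add: GL_def bij_def transpose_apply linear_blinfun_apply)

lemma measurable_transpose [measurable]: "transpose_blinfun \<in> borel_measurable borel"
proof (rule borel_measurable_continuous_onI)
  have eq: "transpose_blinfun g - transpose_blinfun h = transpose_blinfun (g - h)" for g h :: "'a \<Rightarrow>\<^sub>L 'a"
    by (rule transpose_eqI[symmetric]) (simp add: inner_transpose blinfun.diff_left inner_diff_left inner_diff_right)
  have "norm (transpose_blinfun g) \<le> norm g" for g :: "'a \<Rightarrow>\<^sub>L 'a"
    by (intro norm_blinfun_bound norm_transpose_apply_le norm_blinfun) simp
  then have "1-lipschitz_on UNIV (transpose_blinfun :: _ \<Rightarrow> 'a \<Rightarrow>\<^sub>L 'a)"
    by (intro lipschitz_onI) (auto simp: dist_norm eq)
  then show "continuous_on UNIV (transpose_blinfun :: _ \<Rightarrow> 'a \<Rightarrow>\<^sub>L 'a)"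
    by (rule lipschitz_on_continuous_on)
qed

lemma measurable_transpose_GL: "transpose_blinfun \<in> measurable GL_borel GL_borel"
  by (intro measurable_GL_borelI borel_measurable_GL_borel measurable_transpose) (simp add: transpose_GL)

text \<open>The quantity whose logarithm has to be integrable for the first moment to be finite. It bounds
  the growth of vectors from both sides (\<open>distortion_le_iff\<close>); measurability, submultiplicativity
  and behaviour under transposition are read off from that description.\<close>

definition distortion :: "('a::euclidean_space \<Rightarrow>\<^sub>L 'a) \<Rightarrow> real" where
  "distortion g = max (norm g) (onorm (inv (blinfun_apply g)))"

lemma distortion_le_iff:
  assumes g: "g \<in> GL"
  shows "distortion g \<le> c \<longleftrightarrow> (\<forall>v. norm (blinfun_apply g v) \<le> c * norm v \<and> norm v \<le> c * norm (blinfun_apply g v))"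
proof -
  have bij: "bij (blinfun_apply g)" using g by (simp add: GL_def)
  have "linear (inv (blinfun_apply g))"
    using bij by (intro inj_linear_imp_inv_linear) (auto simp: bij_def linear_blinfun_apply)
  then have bl: "bounded_linear (inv (blinfun_apply g))" by (simp add: linear_conv_bounded_linear)
  have inv: "inv (blinfun_apply g) (blinfun_apply g v) = v" for v using bij by (simp add: bij_def)
  have inv': "blinfun_apply g (inv (blinfun_apply g) v) = v" for v using bij by (simp add: bij_def surj_f_inv_f)
  have "norm g \<le> c \<longleftrightarrow> (\<forall>v. norm (blinfun_apply g v) \<le> c * norm v)"
  proof
    assume "norm g \<le> c"
    then show "\<forall>v. norm (blinfun_apply g v) \<le> c * norm v"
      using norm_blinfun[of g] by (meson mult_right_mono norm_ge_zero order_trans)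
  next
    assume "\<forall>v. norm (blinfun_apply g v) \<le> c * norm v"
    then show "norm g \<le> c" unfolding norm_blinfun.rep_eq by (intro onorm_le) auto
  qed
  moreover have "onorm (inv (blinfun_apply g)) \<le> c \<longleftrightarrow> (\<forall>v. norm v \<le> c * norm (blinfun_apply g v))"
  proof
    assume c: "onorm (inv (blinfun_apply g)) \<le> c"
    show "\<forall>v. norm v \<le> c * norm (blinfun_apply g v)"
    proof
      fix v
      have "norm v \<le> onorm (inv (blinfun_apply g)) * norm (blinfun_apply g v)"
        using onorm[OF bl, of "blinfun_apply g v"] by (simp add: inv)
      also have "\<dots> \<le> c * norm (blinfun_apply g v)" by (intro mult_right_mono c) simp
      finally show "norm v \<le> c * norm (blinfun_apply g v)" .
    qed
  next
    assume c: "\<forall>v. norm v \<le> c * norm (blinfun_apply g v)"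
    show "onorm (inv (blinfun_apply g)) \<le> c"
    proof (rule onorm_le)
      show "norm (inv (blinfun_apply g) v) \<le> c * norm v" for v
        using c[rule_format, of "inv (blinfun_apply g) v"] by (simp add: inv')
    qed
  qed
  ultimately show ?thesis unfolding distortion_def by auto
qed

lemma
  assumes g: "g \<in> GL"
  shows apply_le_distortion: "norm (blinfun_apply g v) \<le> distortion g * norm v"
    and le_distortion_apply: "norm v \<le> distortion g * norm (blinfun_apply g v)"
  using distortion_le_iff[OF g, of "distortion g"] by auto

lemma distortion_ge_1:
  assumes g: "g \<in> GL"
  shows "distortion g \<ge> 1"
proof (rule ccontr)
  assume "\<not> ?thesis"
  then have d: "distortion g < 1" by simp
  obtain b :: 'a where b: "b \<in> Basis" by (meson nonempty_Basis equals0I)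
  have d0: "distortion g \<ge> 0" by (simp add: distortion_def le_max_iff_disj)
  have "norm b \<le> distortion g * norm (blinfun_apply g b)" by (rule le_distortion_apply[OF g])
  also have "\<dots> \<le> distortion g * (distortion g * norm b)" using d0 by (intro mult_left_mono apply_le_distortion[OF g])
  also have "\<dots> \<le> distortion g * (1 * norm b)" using d d0 by (intro mult_left_mono mult_right_mono) auto
  finally show False using d b by simp
qed

lemma distortion_compose:
  assumes "g \<in> GL" "h \<in> GL"
  shows "distortion (h o\<^sub>L g) \<le> distortion h * distortion g"
  unfolding distortion_le_iff[OF GL_compose[OF assms]]
proof (intro allI conjI)
  fix v
  have nonneg: "distortion g \<ge> 0" "distortion h \<ge> 0" using distortion_ge_1 assms by fastforce+
  have "norm (blinfun_apply h (blinfun_apply g v)) \<le> distortion h * norm (blinfun_apply g v)"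
    by (rule apply_le_distortion[OF assms(2)])
  also have "\<dots> \<le> distortion h * (distortion g * norm v)"
    by (intro mult_left_mono apply_le_distortion assms nonneg)
  finally show "norm (blinfun_apply (h o\<^sub>L g) v) \<le> distortion h * distortion g * norm v" by simp
  have "norm v \<le> distortion g * norm (blinfun_apply g v)" by (rule le_distortion_apply[OF assms(1)])
  also have "\<dots> \<le> distortion g * (distortion h * norm (blinfun_apply h (blinfun_apply g v)))"
    by (intro mult_left_mono le_distortion_apply assms nonneg)
  finally show "norm v \<le> distortion h * distortion g * norm (blinfun_apply (h o\<^sub>L g) v)" by (simp add: mult_ac)
qed

lemma distortion_transpose:
  assumes g: "g \<in> GL"
  shows "distortion (transpose_blinfun g) \<le> distortion g"
  unfolding distortion_le_iff[OF transpose_GL[OF g]]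
proof (intro allI conjI)
  fix v
  show "norm (blinfun_apply (transpose_blinfun g) v) \<le> distortion g * norm v"
    by (intro norm_transpose_apply_le apply_le_distortion[OF g])
  obtain u where u: "v = blinfun_apply g u" using g unfolding GL_def bij_def surj_def by auto
  have "norm v * norm v = blinfun_apply g u \<bullet> v" unfolding u by (simp add: power2_norm_eq_inner[symmetric] power2_eq_square)
  also have "\<dots> = u \<bullet> blinfun_apply (transpose_blinfun g) v" by (simp add: inner_transpose)
  also have "\<dots> \<le> norm u * norm (blinfun_apply (transpose_blinfun g) v)" by (rule norm_cauchy_schwarz)
  also have "\<dots> \<le> (distortion g * norm v) * norm (blinfun_apply (transpose_blinfun g) v)"
    using le_distortion_apply[OF g, of u] by (intro mult_right_mono) (auto simp: u)
  finally show "norm v \<le> distortion g * norm (blinfun_apply (transpose_blinfun g) v)"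
    using distortion_ge_1[OF g] by (cases "v = 0") (auto simp: mult_ac)
qed

lemma measurable_distortion [measurable]: "distortion \<in> borel_measurable GL_borel"
proof (rule borel_measurableI_le)
  fix c
  let ?C = "(\<Inter>v. {g::'a \<Rightarrow>\<^sub>L 'a. norm (blinfun_apply g v) \<le> c * norm v} \<inter> {g. norm v \<le> c * norm (blinfun_apply g v)})"
  have "closed ?C"
    by (intro closed_INT ballI closed_Int closed_Collect_le continuous_intros)
  then have "GL \<inter> ?C \<in> sets GL_borel"
    unfolding GL_borel_def sets_restrict_space by (intro imageI borel_closed)
  also have "GL \<inter> ?C = {g \<in> space GL_borel. distortion g \<le> c}"
    by (auto simp: distortion_le_iff)
  finally show "{g \<in> space GL_borel. distortion g \<le> c} \<in> sets (GL_borel :: ('a \<Rightarrow>\<^sub>L 'a) measure)" .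
qed

lemma log_cocycle_bound:
  assumes g: "g \<in> GL" and v: "v \<noteq> 0"
  shows "\<bar>ln (norm (blinfun_apply g v) / norm v)\<bar> \<le> ln (distortion g)"
proof -
  let ?r = "norm (blinfun_apply g v) / norm v"
  have pos: "norm (blinfun_apply g v) > 0" "norm v > 0" using v GL_inj[OF g] by auto
  then have r: "?r > 0" by simp
  have d: "distortion g > 0" using distortion_ge_1[OF g] by simp
  have "?r \<le> distortion g" using apply_le_distortion[OF g, of v] pos by (simp add: field_simps)
  moreover have "inverse ?r \<le> distortion g" using le_distortion_apply[OF g, of v] pos by (simp add: field_simps)
  ultimately have "ln ?r \<le> ln (distortion g)" "ln (inverse ?r) \<le> ln (distortion g)"
    using r d by (auto intro!: ln_mono simp del: inverse_divide)
  then show ?thesis using r by (simp add: ln_inverse del: inverse_divide)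
qed

context
  fixes W :: "'a::euclidean_space set"
  assumes W: "subspace W" "W \<noteq> {0}"
begin

lemma bdd_above_growth: "bdd_above ((\<lambda>v. norm (blinfun_apply g v) / norm v) ` W)"
proof (rule bdd_aboveI2)
  fix v show "norm (blinfun_apply g v) / norm v \<le> norm g"
    using norm_blinfun[of g v] by (cases "v = 0") (auto simp: divide_le_eq)
qed

lemma nonzero_vector: obtains w where "w \<in> W" "w \<noteq> 0"
  using W subspace_0[OF W(1)] by blast

lemma norm_on_le_iff:
  assumes "c \<ge> 0"
  shows "norm_on W g \<le> c \<longleftrightarrow> (\<forall>v\<in>W. norm (blinfun_apply g v) \<le> c * norm v)"
proof -
  have *: "(norm (blinfun_apply g v) / norm v \<le> c) = (norm (blinfun_apply g v) \<le> c * norm v)" for v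
    using assms by (cases "v = 0") (auto simp: divide_le_eq blinfun.zero_right)
  have "norm_on W g \<le> c \<longleftrightarrow> (\<forall>v\<in>W. norm (blinfun_apply g v) / norm v \<le> c)"
    unfolding norm_on_def using subspace_0[OF W(1)] by (intro cSUP_le_iff bdd_above_growth) auto
  then show ?thesis by (simp only: *)
qed

lemma norm_on_nonneg: "norm_on W g \<ge> 0"
proof (rule ccontr)
  assume "\<not> ?thesis"
  then have neg: "norm_on W g < 0" by simp
  from cSUP_upper[OF subspace_0[OF W(1)] bdd_above_growth[of g]] neg show False by (simp add: norm_on_def)
qed

lemma apply_le_norm_on: "v \<in> W \<Longrightarrow> norm (blinfun_apply g v) \<le> norm_on W g * norm v"
  using norm_on_le_iff[OF norm_on_nonneg, of g g] by auto

lemma norm_on_ge_apply: "v \<in> W \<Longrightarrow> v \<noteq> 0 \<Longrightarrow> norm (blinfun_apply g v) / norm v \<le> norm_on W g"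
  using apply_le_norm_on[of v g] by (simp add: field_simps)

lemma norm_on_pos: "g \<in> GL \<Longrightarrow> norm_on W g > 0"
proof -
  assume g: "g \<in> GL"
  obtain w where w: "w \<in> W" "w \<noteq> 0" by (rule nonzero_vector)
  have "0 < norm (blinfun_apply g w) / norm w" using w GL_inj[OF g] by simp
  also have "\<dots> \<le> norm_on W g" by (rule norm_on_ge_apply[OF w])
  finally show ?thesis .
qed

lemma norm_on_id: "norm_on W id_blinfun = 1"
proof (rule antisym)
  show "norm_on W id_blinfun \<le> 1" by (subst norm_on_le_iff) auto
  obtain w where w: "w \<in> W" "w \<noteq> 0" by (rule nonzero_vector)
  show "1 \<le> norm_on W id_blinfun" using norm_on_ge_apply[OF w, of id_blinfun] w by simp
qed

lemma norm_on_compose: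
  assumes "blinfun_apply g ` W \<subseteq> W"
  shows "norm_on W (h o\<^sub>L g) \<le> norm_on W h * norm_on W g"
proof (subst norm_on_le_iff)
  show "\<forall>v\<in>W. norm (blinfun_apply (h o\<^sub>L g) v) \<le> norm_on W h * norm_on W g * norm v"
  proof
    fix v assume v: "v \<in> W"
    have "norm (blinfun_apply h (blinfun_apply g v)) \<le> norm_on W h * norm (blinfun_apply g v)"
      using assms v by (intro apply_le_norm_on) auto
    also have "\<dots> \<le> norm_on W h * (norm_on W g * norm v)"
      by (intro mult_left_mono apply_le_norm_on v norm_on_nonneg)
    finally show "norm (blinfun_apply (h o\<^sub>L g) v) \<le> norm_on W h * norm_on W g * norm v" by simp
  qed
qed (simp add: norm_on_nonneg)

lemma abs_ln_norm_on_le: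
  assumes g: "g \<in> GL"
  shows "\<bar>ln (norm_on W g)\<bar> \<le> ln (distortion g)"
proof -
  obtain w where w: "w \<in> W" "w \<noteq> 0" by (rule nonzero_vector)
  have d: "distortion g > 0" using distortion_ge_1[OF g] by simp
  have "norm_on W g \<le> distortion g"
    using d apply_le_distortion[OF g] by (subst norm_on_le_iff) auto
  then have "ln (norm_on W g) \<le> ln (distortion g)" using norm_on_pos[OF g] by (intro ln_mono) auto
  moreover have "ln (norm (blinfun_apply g w) / norm w) \<le> ln (norm_on W g)"
    using w norm_on_ge_apply[OF w, of g] GL_inj[OF g, of w] by (intro ln_mono) auto
  moreover have "\<bar>ln (norm (blinfun_apply g w) / norm w)\<bar> \<le> ln (distortion g)"
    by (rule log_cocycle_bound[OF g w(2)])
  ultimately show ?thesis by linarith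
qed

lemma measurable_norm_on [measurable]: "norm_on W \<in> borel_measurable borel"
proof (rule borel_measurableI_le)
  fix c
  show "{g \<in> space borel. norm_on W g \<le> c} \<in> sets borel"
  proof (cases "c \<ge> 0")
    case True
    have "closed (\<Inter>v\<in>W. {g. norm (blinfun_apply g v) \<le> c * norm v})"
      by (intro closed_INT ballI closed_Collect_le continuous_intros)
    also have "(\<Inter>v\<in>W. {g. norm (blinfun_apply g v) \<le> c * norm v}) = {g \<in> space borel. norm_on W g \<le> c}"
      by (auto simp: norm_on_le_iff[OF True])
    finally show ?thesis by (rule borel_closed)
  next
    case False
    then have "{g. norm_on W g \<le> c} = {}" using norm_on_nonneg by (auto dest: order_trans)
    then show ?thesis by simp
  qed
qed

end

section \<open>Random products and the Furstenberg--Kesten theorem\<close>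

text \<open>A point off the support has a null neighbourhood in a countable base of the topology.\<close>

lemma AE_GL_support:
  assumes "prob_on_GL \<mu>"
  shows "AE g in \<mu>. g \<in> GL_support \<mu>"
proof -
  note \<mu> = prob_on_GL_D[OF assms]
  obtain B :: "('a \<Rightarrow>\<^sub>L 'a) set set" where B: "countable B" "topological_basis B"
    using ex_countable_basis by blast
  have sets: "U \<inter> GL \<in> sets \<mu>" if "open U" for U :: "('a \<Rightarrow>\<^sub>L 'a) set"
    unfolding \<mu>(2) GL_borel_def sets_restrict_space using that
    by (subst Int_commute) (intro imageI borel_open)
  have "AE g in \<mu>. \<forall>b\<in>B. emeasure \<mu> (b \<inter> GL) = 0 \<longrightarrow> g \<notin> b \<inter> GL"
    unfolding AE_ball_countable[OF B(1)]
  proof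
    fix b assume b: "b \<in> B"
    show "AE g in \<mu>. emeasure \<mu> (b \<inter> GL) = 0 \<longrightarrow> g \<notin> b \<inter> GL"
    proof (cases "emeasure \<mu> (b \<inter> GL) = 0")
      case True
      then have "b \<inter> GL \<in> null_sets \<mu>"
        using sets[OF topological_basis_open[OF B(2) b]] by (intro null_setsI)
      from AE_not_in[OF this] show ?thesis by eventually_elim simp
    qed simp
  qed
  with AE_space show ?thesis
  proof eventually_elim
    case (elim g)
    have "emeasure \<mu> (U \<inter> GL) > 0" if U: "open U" "g \<in> U" for U
    proof -
      obtain b where b: "b \<in> B" "g \<in> b" "b \<subseteq> U" by (rule topological_basisE[OF B(2) U])
      have "0 < emeasure \<mu> (b \<inter> GL)" using elim b \<mu>(3) by (auto simp: zero_less_iff_neq_zero)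
      also have "\<dots> \<le> emeasure \<mu> (U \<inter> GL)" using b U by (intro emeasure_mono sets) auto
      finally show ?thesis .
    qed
    then show ?case using elim \<mu>(3) by (auto simp: GL_support_def)
  qed
qed

corollary AE_invariant_subspace:
  assumes "prob_on_GL \<mu>" "invariant_subspace \<mu> W"
  shows "AE g in \<mu>. blinfun_apply g ` W \<subseteq> W"
  using AE_GL_support[OF assms(1)]
  by eventually_elim (use assms(2) in \<open>simp add: invariant_subspace_def\<close>)

lemma rand_prod_add:
  "rand_prod \<omega> (m + n) = rand_prod ((shift ^^ m) \<omega>) n o\<^sub>L rand_prod \<omega> m"
proof (induction n)
  case 0
  show ?case by (simp add: blinfun_eqI)
next
  case (Suc n)
  have "rand_prod \<omega> (m + Suc n) = \<omega> (m + n) o\<^sub>L (rand_prod ((shift ^^ m) \<omega>) n o\<^sub>L rand_prod \<omega> m)"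
    by (simp add: Suc)
  also have "\<dots> = rand_prod ((shift ^^ m) \<omega>) (Suc n) o\<^sub>L rand_prod \<omega> m"
    by (rule blinfun_eqI) (simp add: shift_iterate add.commute)
  finally show ?case .
qed

lemma rand_prod_GL: "(\<And>i. \<omega> i \<in> GL) \<Longrightarrow> rand_prod \<omega> n \<in> GL"
  by (induction n) (auto intro: GL_compose id_GL)

lemma rand_prod_invariant:
  assumes "\<And>i. blinfun_apply (\<omega> i) ` W \<subseteq> W"
  shows "blinfun_apply (rand_prod \<omega> n) ` W \<subseteq> W"
proof (induction n)
  case (Suc n)
  then show ?case using assms[of n] by (auto simp: image_subset_iff)
qed simp

lemma ln_distortion_rand_prod:
  assumes "\<And>i. \<omega> i \<in> GL"
  shows "ln (distortion (rand_prod \<omega> n)) \<le> (\<Sum>i<n. ln (distortion (\<omega> i)))"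
proof (induction n)
  case 0
  have "distortion (id_blinfun :: 'a \<Rightarrow>\<^sub>L 'a) \<le> 1" by (subst distortion_le_iff[OF id_GL]) simp
  then have "ln (distortion (id_blinfun :: 'a \<Rightarrow>\<^sub>L 'a)) \<le> ln 1"
    using distortion_ge_1[OF id_GL, where 'a = 'a] by (intro ln_mono) linarith+
  then show ?case by simp
next
  case (Suc n)
  note GL = assms[of n] rand_prod_GL[of \<omega> n, OF assms]
  have pos: "distortion (\<omega> n) > 0" "distortion (rand_prod \<omega> n) > 0" "distortion (\<omega> n o\<^sub>L rand_prod \<omega> n) > 0"
    using distortion_ge_1[OF GL(1)] distortion_ge_1[OF GL(2)] distortion_ge_1[OF GL_compose[OF GL(2) GL(1)]] by auto
  have "ln (distortion (rand_prod \<omega> (Suc n))) \<le> ln (distortion (\<omega> n) * distortion (rand_prod \<omega> n))"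
    using distortion_compose[OF GL(2) GL(1)] pos by (intro ln_mono) auto
  also have "\<dots> = ln (distortion (\<omega> n)) + ln (distortion (rand_prod \<omega> n))" using pos by (intro ln_mult_pos)
  finally show ?case using Suc by simp
qed

lemma measurable_rand_prod:
  assumes "sets \<mu> = sets GL_borel"
  shows "(\<lambda>\<omega>. rand_prod \<omega> n) \<in> measurable (PiM UNIV (\<lambda>_. \<mu>)) GL_borel"
proof (rule measurable_GL_borelI)
  have "(\<lambda>\<omega>. \<omega> i) \<in> measurable (PiM UNIV (\<lambda>_. \<mu>)) GL_borel" for i :: nat
    using measurable_component_singleton[of i UNIV "\<lambda>_. \<mu>"] by (simp add: measurable_cong_sets[OF refl assms])
  from measurable_of_GL_borel[OF this]
  have [measurable]: "(\<lambda>\<omega>. \<omega> i) \<in> borel_measurable (PiM UNIV (\<lambda>_. \<mu>))" for i :: nat .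
  show "(\<lambda>\<omega>. rand_prod \<omega> n) \<in> borel_measurable (PiM UNIV (\<lambda>_. \<mu>))"
    by (induction n) auto
  show "rand_prod \<omega> n \<in> GL" if "\<omega> \<in> space (PiM UNIV (\<lambda>_. \<mu>))" for \<omega>
    using that sets_eq_imp_space_eq[OF assms] by (intro rand_prod_GL) (auto simp: space_PiM PiE_iff)
qed

lemma finite_first_moment_iff: "finite_first_moment \<mu> \<longleftrightarrow> integrable \<mu> (\<lambda>g. ln (distortion g))"
  by (simp add: finite_first_moment_def distortion_def)

text \<open>By the Furstenberg--Kesten theorem, the infimum of \<open>mean_log_norm \<mu> W n / n\<close> over \<open>n \<ge> 1\<close> is the
  top Lyapunov exponent on \<open>W\<close>, if \<open>W\<close> is a nonzero subspace that almost every map preserves.\<close>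

definition mean_log_norm :: "('a::euclidean_space \<Rightarrow>\<^sub>L 'a) measure \<Rightarrow> 'a set \<Rightarrow> nat \<Rightarrow> real" where
  "mean_log_norm \<mu> W n = (\<integral>\<omega>. ln (norm_on W (rand_prod \<omega> n)) \<partial>PiM UNIV (\<lambda>_. \<mu>))"

locale random_walk =
  fixes \<mu> :: "('a::euclidean_space \<Rightarrow>\<^sub>L 'a) measure"
  assumes GL: "prob_on_GL \<mu>" and moment: "finite_first_moment \<mu>"
begin

sublocale prob_space \<mu> by (rule prob_on_GL_D[OF GL])
sublocale P: sequence_space \<mu> by unfold_locales
sublocale shift: totally_ergodic_map P.S shift
  by (rule bernoulli_shift_totally_ergodic) unfold_locales

lemmas sets_eq = prob_on_GL_D(2)[OF GL]
lemmas space_eq = prob_on_GL_D(3)[OF GL]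

lemma factor_GL: "\<omega> \<in> space P.S \<Longrightarrow> \<omega> i \<in> GL"
  by (auto simp: space_PiM PiE_iff space_eq)

lemma
  assumes "integrable \<mu> h"
  shows integrable_factor: "integrable P.S (\<lambda>\<omega>. h (\<omega> i) :: real)"
    and integral_factor: "(\<integral>\<omega>. h (\<omega> i) \<partial>P.S) = (\<integral>g. h g \<partial>\<mu>)"
proof -
  have d: "distr P.S \<mu> (\<lambda>\<omega>. \<omega> i) = \<mu>" by (rule distr_PiM_component) (auto intro: prob_space_axioms)
  show "integrable P.S (\<lambda>\<omega>. h (\<omega> i))"
    by (rule integrable_distr[of "\<lambda>\<omega>. \<omega> i" _ \<mu>]) (auto simp: d assms)
  have "(\<integral>g. h g \<partial>distr P.S \<mu> (\<lambda>\<omega>. \<omega> i)) = (\<integral>\<omega>. h (\<omega> i) \<partial>P.S)"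
    using assms by (intro integral_distr) auto
  then show "(\<integral>\<omega>. h (\<omega> i) \<partial>P.S) = (\<integral>g. h g \<partial>\<mu>)" by (simp add: d)
qed

lemma AE_factor: "AE g in \<mu>. Q g \<Longrightarrow> AE \<omega> in P.S. \<forall>i. Q (\<omega> i)"
  by (subst AE_all_countable) (auto intro!: AE_PiM_component prob_space_axioms)

lemma integrable_bounded_by_distortion:
  assumes "F \<in> borel_measurable GL_borel" "\<And>g. g \<in> GL \<Longrightarrow> \<bar>F g\<bar> \<le> ln (distortion g)"
  shows "integrable P.S (\<lambda>\<omega>. F (rand_prod \<omega> n) :: real)"
    and "\<bar>\<integral>\<omega>. F (rand_prod \<omega> n) \<partial>P.S\<bar> \<le> real n * (\<integral>g. ln (distortion g) \<partial>\<mu>)"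
proof -
  have mom: "integrable \<mu> (\<lambda>g. ln (distortion g))" using moment by (simp add: finite_first_moment_iff)
  have sum: "integrable P.S (\<lambda>\<omega>. \<Sum>i<n. ln (distortion (\<omega> i)))"
    by (intro Bochner_Integration.integrable_sum integrable_factor mom)
  have bound: "\<bar>F (rand_prod \<omega> n)\<bar> \<le> (\<Sum>i<n. ln (distortion (\<omega> i)))" if "\<omega> \<in> space P.S" for \<omega>
    by (rule order_trans[OF assms(2)[OF rand_prod_GL] ln_distortion_rand_prod]) (rule factor_GL[OF that])+
  have meas: "(\<lambda>\<omega>. F (rand_prod \<omega> n)) \<in> borel_measurable P.S"
    by (rule measurable_compose[OF measurable_rand_prod[OF sets_eq] assms(1)])
  show int: "integrable P.S (\<lambda>\<omega>. F (rand_prod \<omega> n))"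
  proof (rule Bochner_Integration.integrable_bound[OF sum meas], rule AE_I2)
    fix \<omega> assume "\<omega> \<in> space P.S"
    then show "norm (F (rand_prod \<omega> n)) \<le> norm (\<Sum>i<n. ln (distortion (\<omega> i)))"
      using bound[of \<omega>] by simp
  qed
  have "\<bar>\<integral>\<omega>. F (rand_prod \<omega> n) \<partial>P.S\<bar> \<le> (\<integral>\<omega>. \<bar>F (rand_prod \<omega> n)\<bar> \<partial>P.S)"
    by (rule integral_abs_bound)
  also have "\<dots> \<le> (\<integral>\<omega>. (\<Sum>i<n. ln (distortion (\<omega> i))) \<partial>P.S)"
    using bound int by (intro integral_mono sum) auto
  also have "\<dots> = real n * (\<integral>g. ln (distortion g) \<partial>\<mu>)"
    by (subst Bochner_Integration.integral_sum) (auto simp: integrable_factor[OF mom] integral_factor[OF mom])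
  finally show "\<bar>\<integral>\<omega>. F (rand_prod \<omega> n) \<partial>P.S\<bar> \<le> real n * (\<integral>g. ln (distortion g) \<partial>\<mu>)" .
qed

context
  fixes W assumes W: "subspace W" "W \<noteq> {0}" and inv: "AE g in \<mu>. blinfun_apply g ` W \<subseteq> W"
begin

lemma measurable_ln_norm_on: "(\<lambda>g. ln (norm_on W g)) \<in> borel_measurable GL_borel"
  by (intro borel_measurable_GL_borel borel_measurable_ln measurable_norm_on W)

lemma integrable_ln_norm_on: "integrable P.S (\<lambda>\<omega>. ln (norm_on W (rand_prod \<omega> n)))"
  by (rule integrable_bounded_by_distortion[OF measurable_ln_norm_on abs_ln_norm_on_le[OF W]])

lemma subadditive_ln_norm_on: "shift.subadditive (\<lambda>n \<omega>. ln (norm_on W (rand_prod \<omega> n)))"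
  unfolding shift.subadditive_def
proof (intro conjI allI integrable_ln_norm_on)
  show "AE \<omega> in P.S. ln (norm_on W (rand_prod \<omega> 0)) = 0 \<and> (\<forall>m n. ln (norm_on W (rand_prod \<omega> (m + n))) \<le>
      ln (norm_on W (rand_prod \<omega> m)) + ln (norm_on W (rand_prod ((shift ^^ m) \<omega>) n)))"
    using AE_factor[OF inv] AE_space
  proof eventually_elim
    case (elim \<omega>)
    have fac: "\<omega> i \<in> GL" for i using elim by (intro factor_GL)
    have GL: "rand_prod \<omega> n \<in> GL" "rand_prod ((shift ^^ m) \<omega>) n \<in> GL" for m n
      unfolding shift_iterate by (rule rand_prod_GL, rule fac)+
    have "ln (norm_on W (rand_prod \<omega> (m + n))) \<le> ln (norm_on W (rand_prod \<omega> m)) + ln (norm_on W (rand_prod ((shift ^^ m) \<omega>) n))" for m n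
    proof -
      have "norm_on W (rand_prod \<omega> (m + n)) \<le> norm_on W (rand_prod ((shift ^^ m) \<omega>) n) * norm_on W (rand_prod \<omega> m)"
        unfolding rand_prod_add using elim by (intro norm_on_compose W rand_prod_invariant) auto
      then have "ln (norm_on W (rand_prod \<omega> (m + n))) \<le> ln (norm_on W (rand_prod ((shift ^^ m) \<omega>) n) * norm_on W (rand_prod \<omega> m))"
        using norm_on_pos[OF W GL(1)] by (intro ln_mono) auto
      also have "\<dots> = ln (norm_on W (rand_prod ((shift ^^ m) \<omega>) n)) + ln (norm_on W (rand_prod \<omega> m))"
        by (intro ln_mult_pos norm_on_pos W GL)
      finally show ?thesis by simp
    qed
    then show ?case by (simp add: norm_on_id[OF W])
  qed
qed

lemma bdd_below_mean_log_norm: "bdd_below ((\<lambda>n. mean_log_norm \<mu> W n / real n) ` {1..})"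
proof (rule bdd_belowI2)
  fix n :: nat assume "n \<in> {1..}"
  then show "- (\<integral>g. ln (distortion g) \<partial>\<mu>) \<le> mean_log_norm \<mu> W n / real n"
    using integrable_bounded_by_distortion(2)[OF measurable_ln_norm_on abs_ln_norm_on_le[OF W], of n]
    unfolding mean_log_norm_def by (simp add: field_simps abs_le_iff)
qed

text \<open>The logarithm of the norm on \<open>W\<close> is subadditive along the shift because almost every factor
  preserves \<open>W\<close>, and the moment condition bounds its means from below by a multiple of \<open>n\<close>. The
  defining description of the exponent is met by exactly one number, as almost sure limits are
  unique.\<close>

theorem furstenberg_kesten: "top_lyapunov_on \<mu> W = (INF n\<in>{1..}. mean_log_norm \<mu> W n / real n)"
proof -
  let ?L = "INF n\<in>{1..}. mean_log_norm \<mu> W n / real n"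
  have lim: "AE \<omega> in P.S. (\<lambda>n. ln (norm_on W (rand_prod \<omega> n)) / real n) \<longlonglongrightarrow> ?L"
    using shift.subadditive_ergodic[OF subadditive_ln_norm_on] bdd_below_mean_log_norm
    unfolding mean_log_norm_def by simp
  show ?thesis
    unfolding top_lyapunov_on_def
  proof (rule the_equality)
    fix l assume "AE \<omega> in P.S. (\<lambda>n. ln (norm_on W (rand_prod \<omega> n)) / real n) \<longlonglongrightarrow> l"
    with lim have "AE \<omega> in P.S. l = ?L" by eventually_elim (rule LIMSEQ_unique)
    then show "l = ?L" by simp
  qed (rule lim)
qed

lemma mean_log_norm_mult: "mean_log_norm \<mu> W (m * k) \<le> real k * mean_log_norm \<mu> W m"
proof (induction k)
  case 0
  then show ?case by (simp add: mean_log_norm_def norm_on_id[OF W])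
next
  case (Suc k)
  have "mean_log_norm \<mu> W (m + m * k) \<le> (\<integral>\<omega>. ln (norm_on W (rand_prod \<omega> m)) + ln (norm_on W (rand_prod ((shift ^^ m) \<omega>) (m * k))) \<partial>P.S)"
    unfolding mean_log_norm_def using subadditive_ln_norm_on shift.integrable_iterate[OF integrable_ln_norm_on]
    by (intro integral_mono_AE Bochner_Integration.integrable_add integrable_ln_norm_on) (auto simp: shift.subadditive_def)
  also have "\<dots> = mean_log_norm \<mu> W m + mean_log_norm \<mu> W (m * k)"
    unfolding mean_log_norm_def
    by (subst Bochner_Integration.integral_add)
       (auto simp: integrable_ln_norm_on shift.integrable_iterate[OF integrable_ln_norm_on] shift.integral_iterate[OF integrable_ln_norm_on])
  finally show ?case using Suc by (simp add: algebra_simps)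
qed

end

end

section \<open>Projective space as a measurable space\<close>

lemma proj_cases:
  assumes "L \<in> proj UNIV"
  obtains v where "v \<noteq> 0" "L = span {v}"
  using assms by (auto simp: proj_def)

lemma space_proj_borel [simp]: "space proj_borel = proj UNIV"
  by (auto simp: proj_borel_def intro!: space_measure_of)

lemma sets_proj_borel: "sets proj_borel = sigma_sets (proj UNIV) {U. U \<subseteq> proj UNIV \<and> open {v. v \<noteq> 0 \<and> span {v} \<in> U}}"
  unfolding proj_borel_def by (rule sets_measure_of) auto

text \<open>A function on lines whose composition with \<open>v \<mapsto> span {v}\<close> is continuous is Borel: preimages of
  open sets are generators.\<close>

lemma measurable_proj_borelI:
  fixes f :: "'a::euclidean_space set \<Rightarrow> 'b::topological_space"
  assumes "continuous_on (- {0}) (\<lambda>v. f (span {v}))"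
  shows "f \<in> borel_measurable proj_borel"
proof (rule borel_measurableI)
  fix S :: "'b set" assume "open S"
  with assms have "open ((\<lambda>v. f (span {v})) -` S \<inter> (- {0}))"
    by (subst (asm) continuous_on_open_vimage) auto
  also have "(\<lambda>v. f (span {v})) -` S \<inter> (- {0}) = {v. v \<noteq> 0 \<and> span {v} \<in> f -` S \<inter> space proj_borel}"
    by (auto simp: proj_def)
  finally show "f -` S \<inter> space proj_borel \<in> sets proj_borel"
    unfolding sets_proj_borel by (intro sigma_sets.Basic) auto
qed

lemma measurable_span:
  assumes h [measurable]: "h \<in> borel_measurable M" and nz: "\<And>x. x \<in> space M \<Longrightarrow> h x \<noteq> 0"
  shows "(\<lambda>x. span {h x}) \<in> measurable M proj_borel"
proof (rule measurable_sigma_sets[OF sets_proj_borel])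
  fix U assume "U \<in> {U. U \<subseteq> proj UNIV \<and> open {v::'b. v \<noteq> 0 \<and> span {v} \<in> U}}"
  then have "{v. v \<noteq> 0 \<and> span {v} \<in> U} \<in> sets borel" by auto
  have "(\<lambda>x. span {h x}) -` U \<inter> space M = h -` {v. v \<noteq> 0 \<and> span {v} \<in> U} \<inter> space M" using nz by auto
  moreover have "h -` {v. v \<noteq> 0 \<and> span {v} \<in> U} \<inter> space M \<in> sets M" by (rule measurable_sets[OF h]) fact
  ultimately show "(\<lambda>x. span {h x}) -` U \<inter> space M \<in> sets M" by simp
qed (use nz in \<open>auto simp: proj_def\<close>)

text \<open>The orthogonal projection of \<open>b\<close> to the line \<open>L\<close>, written with an arbitrary spanning vector of
  \<open>L\<close> since the value does not depend on it (\<open>line_projection_span\<close>).\<close>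

definition line_projection :: "'a::euclidean_space set \<Rightarrow> 'a \<Rightarrow> 'a" where
  "line_projection L b = (let v = SOME v. v \<in> L \<and> v \<noteq> 0 in ((v \<bullet> b) / (v \<bullet> v)) *\<^sub>R v)"

lemma line_projection_span:
  assumes "v \<noteq> 0"
  shows "line_projection (span {v}) b = ((v \<bullet> b) / (v \<bullet> v)) *\<^sub>R v"
proof -
  define u where "u = (SOME u. u \<in> span {v} \<and> u \<noteq> 0)"
  have "u \<in> span {v} \<and> u \<noteq> 0"
    unfolding u_def by (rule someI[of _ v]) (use assms in \<open>simp add: span_base\<close>)
  then obtain k where k: "u = k *\<^sub>R v" "k \<noteq> 0" by (auto simp: span_singleton)
  have "line_projection (span {v}) b = ((u \<bullet> b) / (u \<bullet> u)) *\<^sub>R u"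
    by (simp add: line_projection_def u_def Let_def)
  also have "\<dots> = ((v \<bullet> b) / (v \<bullet> v)) *\<^sub>R v" using k assms by (simp add: field_simps)
  finally show ?thesis .
qed

lemma measurable_line_projection [measurable]: "(\<lambda>L. line_projection L b) \<in> borel_measurable proj_borel"
proof (rule measurable_proj_borelI)
  have "continuous_on (- {0}) (\<lambda>v. ((v \<bullet> b) / (v \<bullet> v)) *\<^sub>R v)" by (intro continuous_intros) auto
  then show "continuous_on (- {0}) (\<lambda>v. line_projection (span {v}) b)"
    by (rule continuous_on_eq) (simp add: line_projection_span)
qed

text \<open>A measurable choice of a spanning vector in each line: project the vectors of a basis to the line
  and take the first projection that does not vanish. With it, measurability of a function of
  a line that is given through a spanning vector reduces to measurability of a function of a vector.\<close>

primrec first_projection :: "'a::euclidean_space set \<Rightarrow> 'a list \<Rightarrow> 'a" where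
  "first_projection L [] = 0"
| "first_projection L (b # bs) = (if line_projection L b \<noteq> 0 then line_projection L b else first_projection L bs)"

definition line_vector :: "'a::euclidean_space set \<Rightarrow> 'a" where
  "line_vector L = first_projection L (SOME bs. set bs = Basis)"

lemma measurable_line_vector [measurable]: "line_vector \<in> borel_measurable proj_borel"
proof -
  have "(\<lambda>L. first_projection L bs) \<in> borel_measurable proj_borel" for bs :: "'a list"
    by (induction bs) auto
  then show ?thesis unfolding line_vector_def[abs_def] .
qed

lemma line_vector:
  assumes "L \<in> proj UNIV"
  shows "line_vector L \<noteq> 0" and "span {line_vector L} = L"
proof -
  obtain v where v: "v \<noteq> 0" "L = span {v}" using assms by (rule proj_cases)
  have *: "\<exists>k. k \<noteq> 0 \<and> first_projection L bs = k *\<^sub>R v" if "\<exists>b\<in>set bs. v \<bullet> b \<noteq> 0" for bs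
    using that
  proof (induction bs)
    case (Cons b bs)
    show ?case
    proof (cases "v \<bullet> b = 0")
      case True
      then show ?thesis using Cons v by (auto simp: line_projection_span)
    next
      case False
      then show ?thesis using v by (auto simp: line_projection_span intro!: exI[of _ "(v \<bullet> b) / (v \<bullet> v)"])
    qed
  qed simp
  obtain bs :: "'a list" where "set bs = Basis" using finite_list[OF finite_Basis] by blast
  then have "set (SOME bs. set bs = (Basis :: 'a set)) = Basis" by (rule someI)
  moreover have "\<exists>b\<in>Basis. v \<bullet> b \<noteq> 0" using v(1) euclidean_all_zero_iff[of v] by blast
  ultimately obtain k where k: "k \<noteq> 0" "line_vector L = k *\<^sub>R v"
    using *[of "SOME bs. set bs = Basis"] unfolding line_vector_def by auto
  then show "line_vector L \<noteq> 0" using v by simp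
  show "span {line_vector L} = L"
    using span_image_scale[of "{v}" "\<lambda>_. k"] k v by simp
qed

lemma proj_act_span: "proj_act g (span {v}) = span {blinfun_apply g v}"
  by (auto simp: proj_act_def span_singleton blinfun.scaleR_right image_iff)

lemma proj_act_eq: "L \<in> proj UNIV \<Longrightarrow> proj_act g L = span {blinfun_apply g (line_vector L)}"
  using proj_act_span[of g "line_vector L"] by (simp add: line_vector)

lemma proj_act_compose: "proj_act (h o\<^sub>L g) L = proj_act h (proj_act g L)"
  by (simp add: proj_act_def image_image)

lemma proj_act_in: "g \<in> GL \<Longrightarrow> L \<in> proj UNIV \<Longrightarrow> proj_act g L \<in> proj UNIV"
  by (erule proj_cases) (auto simp: proj_act_span proj_def GL_inj)

lemma log_cocycle_eq:
  "L \<in> proj UNIV \<Longrightarrow> log_cocycle g L = ln (norm (blinfun_apply g (line_vector L)) / norm (line_vector L))"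
  using log_cocycle_span[of "line_vector L" g] by (simp add: line_vector)

lemma log_cocycle_compose:
  assumes "g \<in> GL" "h \<in> GL" "L \<in> proj UNIV"
  shows "log_cocycle (h o\<^sub>L g) L = log_cocycle h (proj_act g L) + log_cocycle g L"
proof -
  let ?v = "line_vector L"
  have v: "?v \<noteq> 0" "blinfun_apply g ?v \<noteq> 0" "blinfun_apply h (blinfun_apply g ?v) \<noteq> 0"
    using assms by (auto simp: line_vector GL_inj)
  have "log_cocycle h (proj_act g L) = ln (norm (blinfun_apply h (blinfun_apply g ?v)) / norm (blinfun_apply g ?v))"
    using v by (simp add: proj_act_eq[OF assms(3)] log_cocycle_span)
  then show ?thesis using v by (simp add: log_cocycle_eq[OF assms(3)] ln_div)
qed

lemma abs_log_cocycle_le: "g \<in> GL \<Longrightarrow> L \<in> proj UNIV \<Longrightarrow> \<bar>log_cocycle g L\<bar> \<le> ln (distortion g)"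
  by (simp add: log_cocycle_eq log_cocycle_bound line_vector)

lemma measurable_fst_GL: "fst \<in> borel_measurable (GL_borel \<Otimes>\<^sub>M N)"
  by (rule measurable_of_GL_borel) simp

lemma measurable_proj_act: "(\<lambda>x. proj_act (fst x) (snd x)) \<in> measurable (GL_borel \<Otimes>\<^sub>M proj_borel) proj_borel"
proof -
  note [measurable] = measurable_fst_GL
  have "(\<lambda>x. span {blinfun_apply (fst x) (line_vector (snd x))}) \<in> measurable (GL_borel \<Otimes>\<^sub>M (proj_borel :: 'a set measure)) proj_borel"
    by (rule measurable_span) (auto simp: space_pair_measure GL_inj line_vector)
  then show ?thesis
    by (rule measurable_cong[THEN iffD1, rotated]) (auto simp: space_pair_measure proj_act_eq)
qed

lemma measurable_log_cocycle: "(\<lambda>x. log_cocycle (fst x) (snd x)) \<in> borel_measurable (GL_borel \<Otimes>\<^sub>M proj_borel)"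
proof -
  note [measurable] = measurable_fst_GL
  have "(\<lambda>x. ln (norm (blinfun_apply (fst x) (line_vector (snd x))) / norm (line_vector (snd x)))) 
      \<in> borel_measurable (GL_borel \<Otimes>\<^sub>M (proj_borel :: 'a set measure))"
    by measurable
  then show ?thesis
    by (rule measurable_cong[THEN iffD1, rotated]) (auto simp: space_pair_measure log_cocycle_eq)
qed

section \<open>Stationary measures and convolution\<close>

locale stationary_pair =
  fixes \<kappa> :: "('a::euclidean_space \<Rightarrow>\<^sub>L 'a) measure" and \<nu> :: "'a set measure"
  assumes GL: "prob_on_GL \<kappa>" and stationary: "stationary \<kappa> \<nu>"
begin

sublocale K: prob_space \<kappa> by (rule prob_on_GL_D[OF GL])
sublocale N: prob_space \<nu> using stationary by (simp add: stationary_def)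
sublocale pair_prob_space \<kappa> \<nu> ..

lemma sets_\<nu>: "sets \<nu> = sets proj_borel" and law: "convolve \<kappa> \<nu> = \<nu>"
  using stationary by (auto simp: stationary_def)

lemma space_\<nu>: "space \<nu> = proj UNIV"
  using sets_eq_imp_space_eq[OF sets_\<nu>] by simp

lemmas sets_\<kappa> = prob_on_GL_D(2)[OF GL]
lemmas space_\<kappa> = prob_on_GL_D(3)[OF GL]

lemma measurable_pair_eq: "measurable (\<kappa> \<Otimes>\<^sub>M \<nu>) R = measurable (GL_borel \<Otimes>\<^sub>M proj_borel) R"
  by (intro measurable_cong_sets sets_pair_measure_cong sets_\<kappa> sets_\<nu> refl)

lemma space_pair: "space (\<kappa> \<Otimes>\<^sub>M \<nu>) = GL \<times> proj UNIV"
  by (simp add: space_pair_measure space_\<kappa> space_\<nu>)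

lemma act_measurable: "(\<lambda>x. proj_act (fst x) (snd x)) \<in> measurable (\<kappa> \<Otimes>\<^sub>M \<nu>) proj_borel"
  unfolding measurable_pair_eq by (rule measurable_proj_act)

lemma distr_act: "distr (\<kappa> \<Otimes>\<^sub>M \<nu>) proj_borel (\<lambda>x. proj_act (fst x) (snd x)) = \<nu>"
  using law by (simp add: convolve_def case_prod_beta')

lemma nn_integral_act:
  assumes "F \<in> borel_measurable proj_borel"
  shows "(\<integral>\<^sup>+x. F (proj_act (fst x) (snd x)) \<partial>(\<kappa> \<Otimes>\<^sub>M \<nu>)) = (\<integral>\<^sup>+L. F L \<partial>\<nu>)"
  using nn_integral_distr[OF act_measurable, of F] assms by (simp add: distr_act measurable_cong_sets[OF sets_\<nu> refl])

lemma integral_act: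
  fixes F :: "'a set \<Rightarrow> real"
  assumes "F \<in> borel_measurable proj_borel"
  shows "(\<integral>x. F (proj_act (fst x) (snd x)) \<partial>(\<kappa> \<Otimes>\<^sub>M \<nu>)) = (\<integral>L. F L \<partial>\<nu>)"
  using integral_distr[OF act_measurable assms] by (simp add: distr_act)

lemma distr_fst: "distr (\<kappa> \<Otimes>\<^sub>M \<nu>) \<kappa> fst = \<kappa>"
  by (rule N.distr_pair_fst)

lemma integrable_fst_coord:
  assumes "integrable \<kappa> h"
  shows "integrable (\<kappa> \<Otimes>\<^sub>M \<nu>) (\<lambda>x. h (fst x) :: real)"
  by (rule integrable_distr[OF measurable_fst]) (simp add: distr_fst assms)

lemma integrable_log_cocycle:
  assumes "finite_first_moment \<kappa>"
  shows "integrable (\<kappa> \<Otimes>\<^sub>M \<nu>) (\<lambda>x. log_cocycle (fst x) (snd x))"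
proof (rule Bochner_Integration.integrable_bound)
  show "integrable (\<kappa> \<Otimes>\<^sub>M \<nu>) (\<lambda>x. ln (distortion (fst x)))"
    using assms by (intro integrable_fst_coord) (simp add: finite_first_moment_iff)
  show "(\<lambda>x. log_cocycle (fst x) (snd x)) \<in> borel_measurable (\<kappa> \<Otimes>\<^sub>M \<nu>)"
    unfolding measurable_pair_eq by (rule measurable_log_cocycle)
  show "AE x in \<kappa> \<Otimes>\<^sub>M \<nu>. norm (log_cocycle (fst x) (snd x)) \<le> norm (ln (distortion (fst x)))"
    using abs_log_cocycle_le by (intro AE_I2) (fastforce simp: space_pair)
qed

lemma cocycle_average_eq:
  assumes "finite_first_moment \<kappa>"
  shows "cocycle_average \<kappa> \<nu> = (\<integral>x. log_cocycle (fst x) (snd x) \<partial>(\<kappa> \<Otimes>\<^sub>M \<nu>))"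
  unfolding cocycle_average_def
  using integral_snd[of "\<lambda>g L. log_cocycle g L"] integrable_log_cocycle[OF assms] 
  by (simp add: case_prod_beta')

end

text \<open>A measure that is stationary for two laws is stationary for the law of the product of independent
  maps, and the averages add up by the cocycle relation. Both are Fubini's theorem: average first
  over the later map, which gives a function \<open>G\<close>, respectively \<open>H\<close>, of lines alone, and then apply
  stationarity for the earlier map to that function.\<close>

lemma stationary_compose:
  assumes 1: "stationary_pair \<kappa>1 \<nu>" and 2: "stationary_pair \<kappa>2 \<nu>"
    and \<kappa>: "\<kappa> = distr (\<kappa>1 \<Otimes>\<^sub>M \<kappa>2) GL_borel (\<lambda>x. snd x o\<^sub>L fst x)"
  shows "stationary_pair \<kappa> \<nu>"
    and "finite_first_moment \<kappa>1 \<Longrightarrow> finite_first_moment \<kappa>2 \<Longrightarrow> finite_first_moment \<kappa> \<Longrightarrow> 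
      cocycle_average \<kappa> \<nu> = cocycle_average \<kappa>1 \<nu> + cocycle_average \<kappa>2 \<nu>"
proof -
  interpret A: stationary_pair \<kappa>1 \<nu> by fact
  interpret B: stationary_pair \<kappa>2 \<nu> by fact
  interpret K: pair_prob_space \<kappa>1 \<kappa>2 ..
  have space_K: "space (\<kappa>1 \<Otimes>\<^sub>M \<kappa>2) = GL \<times> GL" by (simp add: space_pair_measure A.space_\<kappa> B.space_\<kappa>)
  have "fst \<in> measurable (\<kappa>1 \<Otimes>\<^sub>M \<kappa>2) GL_borel" "snd \<in> measurable (\<kappa>1 \<Otimes>\<^sub>M \<kappa>2) GL_borel"
    using measurable_fst[of \<kappa>1 \<kappa>2] measurable_snd[of \<kappa>1 \<kappa>2] 
      measurable_cong_sets[OF refl A.sets_\<kappa>] measurable_cong_sets[OF refl B.sets_\<kappa>] by auto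
  note [measurable] = this this[THEN measurable_of_GL_borel]
  have comp [measurable]: "(\<lambda>x. snd x o\<^sub>L fst x) \<in> measurable (\<kappa>1 \<Otimes>\<^sub>M \<kappa>2) GL_borel"
    by (rule measurable_GL_borelI) (auto simp: space_K intro: GL_compose)
  have GL: "prob_on_GL \<kappa>" unfolding prob_on_GL_def \<kappa> using K.prob_space_distr[OF comp] by simp
  interpret P: prob_space \<kappa> by (rule prob_on_GL_D[OF GL])
  interpret PN: pair_prob_space \<kappa> \<nu> ..
  have pair_eq: "measurable (\<kappa> \<Otimes>\<^sub>M \<nu>) R = measurable (GL_borel \<Otimes>\<^sub>M proj_borel) R" for R :: "'c measure"
    by (intro measurable_cong_sets sets_pair_measure_cong prob_on_GL_D(2)[OF GL] A.sets_\<nu> refl)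
  have line: "(\<lambda>g. (g, L)) \<in> measurable GL_borel (GL_borel \<Otimes>\<^sub>M proj_borel)" if "L \<in> proj UNIV" for L
    using that by (intro measurable_Pair2') simp
  have act [measurable]: "(\<lambda>g. proj_act g L) \<in> measurable GL_borel proj_borel" if "L \<in> proj UNIV" for L
    using measurable_compose[OF line[OF that] measurable_proj_act] by simp
  show st: "stationary_pair \<kappa> \<nu>"
  proof
    show "prob_on_GL \<kappa>" by (rule GL)
    have "convolve \<kappa> \<nu> = \<nu>"
    proof (rule measure_eqI)
      fix A assume "A \<in> sets (convolve \<kappa> \<nu>)"
      then have A [measurable]: "A \<in> sets proj_borel" by (simp add: convolve_def)
      let ?F = "indicator A :: 'a set \<Rightarrow> ennreal"
      have F_act: "(\<lambda>x. ?F (proj_act (fst x) (snd x))) \<in> borel_measurable (GL_borel \<Otimes>\<^sub>M proj_borel)"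
        by (rule measurable_compose[OF measurable_proj_act]) simp
      define G where "G L = (\<integral>\<^sup>+h. ?F (proj_act h L) \<partial>\<kappa>2)" for L
      have "(\<lambda>L. \<integral>\<^sup>+h. (\<lambda>(L, h). ?F (proj_act h L)) (L, h) \<partial>\<kappa>2) \<in> borel_measurable \<nu>"
        by (rule B.K.borel_measurable_nn_integral_fst, subst measurable_pair_swap_iff)
           (use F_act in \<open>simp add: B.measurable_pair_eq case_prod_beta'\<close>)
      then have G [measurable]: "G \<in> borel_measurable proj_borel"
        unfolding G_def by (simp add: measurable_cong_sets[OF A.sets_\<nu> refl])
      have "emeasure (convolve \<kappa> \<nu>) A = (\<integral>\<^sup>+L. ?F L \<partial>convolve \<kappa> \<nu>)"
        by (rule nn_integral_indicator[symmetric]) (simp add: convolve_def)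
      also have "\<dots> = (\<integral>\<^sup>+x. ?F (proj_act (fst x) (snd x)) \<partial>(\<kappa> \<Otimes>\<^sub>M \<nu>))"
        unfolding convolve_def case_prod_beta' by (rule nn_integral_distr) (simp_all add: pair_eq measurable_proj_act)
      also have "\<dots> = (\<integral>\<^sup>+L. \<integral>\<^sup>+g. ?F (proj_act g L) \<partial>\<kappa> \<partial>\<nu>)"
        using PN.nn_integral_snd[of "\<lambda>x. ?F (proj_act (fst x) (snd x))"] F_act by (simp add: pair_eq)
      also have "\<dots> = (\<integral>\<^sup>+L. \<integral>\<^sup>+g. G (proj_act g L) \<partial>\<kappa>1 \<partial>\<nu>)"
      proof (rule nn_integral_cong)
        fix L assume "L \<in> space \<nu>"
        then have L: "L \<in> proj UNIV" by (simp add: A.space_\<nu>)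
        have "(\<integral>\<^sup>+g. ?F (proj_act g L) \<partial>\<kappa>) = (\<integral>\<^sup>+x. ?F (proj_act (snd x o\<^sub>L fst x) L) \<partial>(\<kappa>1 \<Otimes>\<^sub>M \<kappa>2))"
          unfolding \<kappa> using act[OF L] by (intro nn_integral_distr) auto
        also have "\<dots> = (\<integral>\<^sup>+g. \<integral>\<^sup>+h. ?F (proj_act (h o\<^sub>L g) L) \<partial>\<kappa>2 \<partial>\<kappa>1)"
          using B.K.nn_integral_fst[of "\<lambda>x. ?F (proj_act (snd x o\<^sub>L fst x) L)" \<kappa>1] act[OF L] by simp
        finally show "(\<integral>\<^sup>+g. ?F (proj_act g L) \<partial>\<kappa>) = (\<integral>\<^sup>+g. G (proj_act g L) \<partial>\<kappa>1)"
          by (simp add: G_def proj_act_compose)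
      qed
      also have "\<dots> = (\<integral>\<^sup>+x. G (proj_act (fst x) (snd x)) \<partial>(\<kappa>1 \<Otimes>\<^sub>M \<nu>))"
        using A.nn_integral_snd[of "\<lambda>x. G (proj_act (fst x) (snd x))"] measurable_compose[OF A.act_measurable G] by simp
      also have "\<dots> = (\<integral>\<^sup>+L. G L \<partial>\<nu>)" by (rule A.nn_integral_act[OF G])
      also have "\<dots> = (\<integral>\<^sup>+x. ?F (proj_act (fst x) (snd x)) \<partial>(\<kappa>2 \<Otimes>\<^sub>M \<nu>))"
        unfolding G_def using B.nn_integral_snd[of "\<lambda>x. ?F (proj_act (fst x) (snd x))"] F_act 
        by (simp add: B.measurable_pair_eq)
      also have "\<dots> = (\<integral>\<^sup>+L. ?F L \<partial>\<nu>)" by (rule B.nn_integral_act) simp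
      also have "\<dots> = emeasure \<nu> A" using A by (intro nn_integral_indicator) (simp add: A.sets_\<nu>)
      finally show "emeasure (convolve \<kappa> \<nu>) A = emeasure \<nu> A" .
    qed (simp add: convolve_def A.sets_\<nu>)
    then show "stationary \<kappa> \<nu>" using A.stationary by (simp add: stationary_def)
  qed
  assume m1: "finite_first_moment \<kappa>1" and m2: "finite_first_moment \<kappa>2" and m: "finite_first_moment \<kappa>"
  define H where "H L = (\<integral>h. log_cocycle h L \<partial>\<kappa>2)" for L
  have i2: "integrable \<kappa>2 (\<lambda>g. ln (distortion g))" and i1: "integrable \<kappa>1 (\<lambda>g. ln (distortion g))"
    using m1 m2 by (simp_all add: finite_first_moment_iff)
  have lc_meas: "(\<lambda>g. log_cocycle g L) \<in> borel_measurable GL_borel" if "L \<in> proj UNIV" for L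
    using measurable_compose[OF line[OF that] measurable_log_cocycle] by simp
  have lc2: "integrable \<kappa>2 (\<lambda>g. log_cocycle g L)" if "L \<in> proj UNIV" for L
    by (rule Bochner_Integration.integrable_bound[OF i2])
       (use that lc_meas[OF that] abs_log_cocycle_le in \<open>fastforce simp: B.space_\<kappa> measurable_cong_sets[OF B.sets_\<kappa> refl] intro!: AE_I2\<close>)+
  have lc1: "integrable \<kappa>1 (\<lambda>g. log_cocycle g L)" if "L \<in> proj UNIV" for L
    by (rule Bochner_Integration.integrable_bound[OF i1])
       (use that lc_meas[OF that] abs_log_cocycle_le in \<open>fastforce simp: A.space_\<kappa> measurable_cong_sets[OF A.sets_\<kappa> refl] intro!: AE_I2\<close>)+
  have H_bound: "\<bar>H L\<bar> \<le> (\<integral>g. ln (distortion g) \<partial>\<kappa>2)" if "L \<in> proj UNIV" for L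
  proof -
    have "\<bar>H L\<bar> \<le> (\<integral>h. \<bar>log_cocycle h L\<bar> \<partial>\<kappa>2)" unfolding H_def by (rule integral_abs_bound)
    also have "\<dots> \<le> (\<integral>g. ln (distortion g) \<partial>\<kappa>2)"
      using lc2[OF that] i2 abs_log_cocycle_le[OF _ that] by (intro integral_mono) (auto simp: B.space_\<kappa>)
    finally show ?thesis .
  qed
  have "(\<lambda>L. \<integral>h. log_cocycle h L \<partial>\<kappa>2) \<in> borel_measurable \<nu>"
    by (rule B.K.borel_measurable_lebesgue_integral, subst measurable_pair_swap_iff)
       (use measurable_log_cocycle in \<open>simp add: B.measurable_pair_eq case_prod_beta'\<close>)
  then have H [measurable]: "H \<in> borel_measurable proj_borel"
    unfolding H_def by (simp add: measurable_cong_sets[OF A.sets_\<nu> refl])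
  have H_act1: "integrable \<kappa>1 (\<lambda>g. H (proj_act g L))" if "L \<in> proj UNIV" for L
  proof (rule A.K.integrable_const_bound[where B = "\<integral>g. ln (distortion g) \<partial>\<kappa>2"])
    show "AE g in \<kappa>1. norm (H (proj_act g L)) \<le> (\<integral>g. ln (distortion g) \<partial>\<kappa>2)"
      using H_bound proj_act_in[OF _ that] by (intro AE_I2) (simp add: A.space_\<kappa>)
    show "(\<lambda>g. H (proj_act g L)) \<in> borel_measurable \<kappa>1"
      using measurable_compose[OF act[OF that] H] by (simp add: measurable_cong_sets[OF A.sets_\<kappa> refl])
  qed
  have H_act: "integrable (\<kappa>1 \<Otimes>\<^sub>M \<nu>) (\<lambda>x. H (proj_act (fst x) (snd x)))"
  proof (rule A.P.integrable_const_bound[where B = "\<integral>g. ln (distortion g) \<partial>\<kappa>2"])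
    show "AE x in \<kappa>1 \<Otimes>\<^sub>M \<nu>. norm (H (proj_act (fst x) (snd x))) \<le> (\<integral>g. ln (distortion g) \<partial>\<kappa>2)"
      by (intro AE_I2) (auto simp: A.space_pair intro!: H_bound proj_act_in)
    show "(\<lambda>x. H (proj_act (fst x) (snd x))) \<in> borel_measurable (\<kappa>1 \<Otimes>\<^sub>M \<nu>)"
      by (rule measurable_compose[OF A.act_measurable H])
  qed
  have inner: "(\<integral>g. log_cocycle g L \<partial>\<kappa>) = (\<integral>g. H (proj_act g L) + log_cocycle g L \<partial>\<kappa>1)" if L: "L \<in> proj UNIV" for L
  proof -
    have meas: "(\<lambda>x. log_cocycle (snd x o\<^sub>L fst x) L) \<in> borel_measurable (\<kappa>1 \<Otimes>\<^sub>M \<kappa>2)"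
      by (rule measurable_compose[OF comp lc_meas[OF L]])
    have int_\<kappa>: "integrable \<kappa> (\<lambda>g. log_cocycle g L)"
      by (rule Bochner_Integration.integrable_bound[OF m[unfolded finite_first_moment_iff]])
       (use L lc_meas[OF L] abs_log_cocycle_le in \<open>fastforce simp: prob_on_GL_D(3)[OF GL] measurable_cong_sets[OF prob_on_GL_D(2)[OF GL] refl] intro!: AE_I2\<close>)+
    have int: "integrable (\<kappa>1 \<Otimes>\<^sub>M \<kappa>2) (\<lambda>x. log_cocycle (snd x o\<^sub>L fst x) L)"
      using int_\<kappa> unfolding \<kappa> by (rule integrable_distr[OF comp])
    have "(\<integral>g. log_cocycle g L \<partial>\<kappa>) = (\<integral>x. log_cocycle (snd x o\<^sub>L fst x) L \<partial>(\<kappa>1 \<Otimes>\<^sub>M \<kappa>2))"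
      unfolding \<kappa> by (rule integral_distr[OF comp lc_meas[OF L]])
    also have "\<dots> = (\<integral>g. \<integral>h. log_cocycle (h o\<^sub>L g) L \<partial>\<kappa>2 \<partial>\<kappa>1)"
      using K.integral_fst'[OF int] by simp
    also have "\<dots> = (\<integral>g. H (proj_act g L) + log_cocycle g L \<partial>\<kappa>1)"
    proof (rule Bochner_Integration.integral_cong[OF refl])
      fix g assume "g \<in> space \<kappa>1"
      then have g: "g \<in> GL" by (simp add: A.space_\<kappa>)
      have "(\<integral>h. log_cocycle (h o\<^sub>L g) L \<partial>\<kappa>2) = (\<integral>h. log_cocycle h (proj_act g L) + log_cocycle g L \<partial>\<kappa>2)"
        by (rule Bochner_Integration.integral_cong) (auto simp: log_cocycle_compose g L B.space_\<kappa>)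
      also have "\<dots> = H (proj_act g L) + log_cocycle g L"
        unfolding H_def using lc2[OF proj_act_in[OF g L]] by (simp add: B.K.prob_space)
      finally show "(\<integral>h. log_cocycle (h o\<^sub>L g) L \<partial>\<kappa>2) = H (proj_act g L) + log_cocycle g L" .
    qed
    finally show ?thesis .
  qed
  have "cocycle_average \<kappa> \<nu> = (\<integral>L. \<integral>g. H (proj_act g L) + log_cocycle g L \<partial>\<kappa>1 \<partial>\<nu>)"
    unfolding cocycle_average_def by (rule Bochner_Integration.integral_cong) (simp_all add: inner A.space_\<nu>)
  also have "\<dots> = (\<integral>x. H (proj_act (fst x) (snd x)) + log_cocycle (fst x) (snd x) \<partial>(\<kappa>1 \<Otimes>\<^sub>M \<nu>))"
    using A.integral_snd[of "\<lambda>g L. H (proj_act g L) + log_cocycle g L"] 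
      Bochner_Integration.integrable_add[OF H_act A.integrable_log_cocycle[OF m1]] by (simp add: case_prod_beta')
  also have "\<dots> = (\<integral>L. H L \<partial>\<nu>) + cocycle_average \<kappa>1 \<nu>"
    using H_act A.integrable_log_cocycle[OF m1] by (simp add: A.integral_act[OF H] A.cocycle_average_eq[OF m1])
  finally show "cocycle_average \<kappa> \<nu> = cocycle_average \<kappa>1 \<nu> + cocycle_average \<kappa>2 \<nu>"
    by (simp add: H_def cocycle_average_def)
qed

section \<open>The walk after several steps\<close>

lemma rand_prod_case_nat: "rand_prod (case_nat g \<omega>) (Suc n) = rand_prod \<omega> n o\<^sub>L g"
proof (induction n)
  case (Suc n)
  have "rand_prod (case_nat g \<omega>) (Suc (Suc n)) = \<omega> n o\<^sub>L (rand_prod \<omega> n o\<^sub>L g)"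
    by (subst Suc[symmetric]) simp
  also have "\<dots> = rand_prod \<omega> (Suc n) o\<^sub>L g" by (rule blinfun_eqI) simp
  finally show ?case .
qed (simp add: blinfun_eqI)

context random_walk begin

definition walk_law :: "nat \<Rightarrow> ('a \<Rightarrow>\<^sub>L 'a) measure" where
  "walk_law n = distr P.S GL_borel (\<lambda>\<omega>. rand_prod \<omega> n)"

lemmas measurable_walk [measurable] = measurable_rand_prod[OF sets_eq]

lemma integral_walk_law:
  "F \<in> borel_measurable GL_borel \<Longrightarrow> (\<integral>g. F g \<partial>walk_law n) = (\<integral>\<omega>. F (rand_prod \<omega> n) \<partial>P.S :: real)"
  unfolding walk_law_def by (rule integral_distr[OF measurable_walk])

lemma finite_first_moment_walk_law: "finite_first_moment (walk_law n)"
proof -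
  have meas: "(\<lambda>g :: 'a \<Rightarrow>\<^sub>L 'a. ln (distortion g)) \<in> borel_measurable GL_borel" by measurable
  have "integrable P.S (\<lambda>\<omega>. ln (distortion (rand_prod \<omega> n)))"
    by (rule integrable_bounded_by_distortion[OF meas]) (use distortion_ge_1 in fastforce)
  then show ?thesis
    unfolding finite_first_moment_iff walk_law_def using integrable_distr_eq[OF measurable_walk meas] by simp
qed

lemma walk_law_1: "walk_law 1 = \<mu>"
proof -
  have "walk_law 1 = distr P.S GL_borel (\<lambda>\<omega>. \<omega> 0)"
    unfolding walk_law_def by (rule distr_cong) (auto intro: blinfun_eqI)
  also have "\<dots> = distr P.S \<mu> (\<lambda>\<omega>. \<omega> 0)" by (rule distr_cong) (simp_all add: sets_eq)
  also have "\<dots> = \<mu>" by (rule distr_PiM_component) (auto intro: prob_space_axioms)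
  finally show ?thesis .
qed

text \<open>Splitting off the first factor exhibits the law after \<open>n + 1\<close> steps as a convolution.\<close>

lemma walk_law_Suc: "walk_law (Suc n) = distr (\<mu> \<Otimes>\<^sub>M walk_law n) GL_borel (\<lambda>x. snd x o\<^sub>L fst x)"
proof -
  have cons: "(\<lambda>(g, \<omega>). case_nat g \<omega>) \<in> measurable (\<mu> \<Otimes>\<^sub>M P.S) P.S" by measurable
  have walk: "sigma_finite_measure (distr P.S GL_borel (\<lambda>\<omega>. rand_prod \<omega> n))"
    using P.prob_space_distr[OF measurable_walk] by (simp add: prob_space_imp_sigma_finite)
  have m: "(\<lambda>(g, \<omega>). (g, rand_prod \<omega> n)) \<in> measurable (\<mu> \<Otimes>\<^sub>M P.S) (\<mu> \<Otimes>\<^sub>M GL_borel)" by measurable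
  have m\<mu>: "(\<lambda>g. g) \<in> measurable \<mu> GL_borel" using sets_eq by (intro measurable_ident_sets)
  have "fst \<in> measurable (\<mu> \<Otimes>\<^sub>M GL_borel) (GL_borel :: ('a \<Rightarrow>\<^sub>L 'a) measure)" 
    by (rule measurable_compose[OF measurable_fst m\<mu>])
  note [measurable] = this[THEN measurable_of_GL_borel]
  have "snd \<in> measurable (\<mu> \<Otimes>\<^sub>M GL_borel) (GL_borel :: ('a \<Rightarrow>\<^sub>L 'a) measure)" by measurable
  note [measurable] = this[THEN measurable_of_GL_borel]
  have comp: "(\<lambda>x. snd x o\<^sub>L fst x) \<in> measurable (\<mu> \<Otimes>\<^sub>M GL_borel) GL_borel"
    by (rule measurable_GL_borelI) (auto simp: space_pair_measure space_eq intro: GL_compose)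
  have "walk_law (Suc n) = distr (distr (\<mu> \<Otimes>\<^sub>M P.S) P.S (\<lambda>(g, \<omega>). case_nat g \<omega>)) GL_borel (\<lambda>\<omega>. rand_prod \<omega> (Suc n))"
    unfolding walk_law_def P.PiM_iter ..
  also have "\<dots> = distr (\<mu> \<Otimes>\<^sub>M P.S) GL_borel (\<lambda>(g, \<omega>). rand_prod \<omega> n o\<^sub>L g)"
    by (subst distr_distr[OF measurable_walk cons]) (auto intro!: distr_cong simp: rand_prod_case_nat simp del: rand_prod.simps)
  also have "\<dots> = distr (distr (\<mu> \<Otimes>\<^sub>M P.S) (\<mu> \<Otimes>\<^sub>M GL_borel) (\<lambda>(g, \<omega>). (g, rand_prod \<omega> n))) GL_borel (\<lambda>x. snd x o\<^sub>L fst x)"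
    by (subst distr_distr[OF comp m]) (auto intro!: distr_cong)
  also have "distr (\<mu> \<Otimes>\<^sub>M P.S) (\<mu> \<Otimes>\<^sub>M GL_borel) (\<lambda>(g, \<omega>). (g, rand_prod \<omega> n)) = \<mu> \<Otimes>\<^sub>M walk_law n"
    using pair_measure_distr[of "\<lambda>g. g" \<mu> \<mu> "\<lambda>\<omega>. rand_prod \<omega> n" P.S GL_borel, OF _ measurable_walk walk]
    by (simp add: distr_id2 walk_law_def)
  finally show ?thesis .
qed

lemma
  assumes "stationary \<mu> \<nu>"
  shows stationary_walk_law: "stationary_pair (walk_law (Suc n)) \<nu>"
    and cocycle_average_walk_law: "cocycle_average (walk_law (Suc n)) \<nu> = real (Suc n) * cocycle_average \<mu> \<nu>"
proof (induction n)
  case 0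
  {
    case 1 then show ?case using assms GL walk_law_1 by (simp add: stationary_pair_def)
  next
    case 2 then show ?case using walk_law_1 by simp
  }
next
  case (Suc n)
  have st: "stationary_pair \<mu> \<nu>" using assms GL by (simp add: stationary_pair_def)
  {
    case 1 show ?case by (rule stationary_compose(1)[OF st Suc(1) walk_law_Suc])
  next
    case 2 show ?case
      using stationary_compose(2)[OF st Suc(1) walk_law_Suc moment finite_first_moment_walk_law finite_first_moment_walk_law] Suc(2)
      by (simp add: algebra_simps)
  }
qed

end

section \<open>Lines that are not orthogonal to an invariant subspace\<close>

text \<open>If \<open>A\<close> and \<open>B\<close> were integrable, their means would agree. In general, truncate both at \<open>K\<close>:
  truncation does not increase distances and keeps the order, so the minimum of \<open>h\<close> and the
  truncated difference stays between \<open>- \<bar>h\<bar>\<close> and \<open>\<bar>h\<bar>\<close>, has mean at most zero since the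
  truncations have equal means, and tends to \<open>h\<close>.\<close>

lemma (in prob_space) integral_le_0_of_equal_laws:
  fixes A B h :: "'a \<Rightarrow> real"
  assumes [measurable]: "A \<in> borel_measurable M" "B \<in> borel_measurable M"
    and nonneg: "\<And>x. A x \<ge> 0" "\<And>x. B x \<ge> 0"
    and law: "distr M borel A = distr M borel B"
    and h: "integrable M h" and le: "AE x in M. h x \<le> A x - B x"
  shows "(\<integral>x. h x \<partial>M) \<le> 0"
proof -
  have [measurable]: "h \<in> borel_measurable M" using h by auto
  define m where "m K x = min (h x) (min (A x) (real K) - min (B x) (real K))" for K :: nat and x
  have bound: "AE x in M. \<bar>m K x\<bar> \<le> \<bar>h x\<bar>" for K
    using le by eventually_elim (auto simp: m_def min_def)
  have [measurable]: "m K \<in> borel_measurable M" for K unfolding m_def by measurable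
  have int_m: "integrable M (m K)" for K
    by (rule Bochner_Integration.integrable_bound[OF h]) (use bound[of K] in auto)
  have int: "integrable M (\<lambda>x. min (A x) (real K))" "integrable M (\<lambda>x. min (B x) (real K))" for K :: nat
    using nonneg by (auto intro!: integrable_const_bound[where B = "real K"])
  have m_le: "(\<integral>x. m K x \<partial>M) \<le> 0" for K
  proof -
    have "(\<integral>x. m K x \<partial>M) \<le> (\<integral>x. min (A x) (real K) - min (B x) (real K) \<partial>M)"
      using int by (intro integral_mono int_m) (auto simp: m_def)
    also have "\<dots> = (\<integral>x. min (A x) (real K) \<partial>M) - (\<integral>x. min (B x) (real K) \<partial>M)"
      using int by simp
    also have "(\<integral>x. min (A x) (real K) \<partial>M) = (\<integral>a. min a (real K) \<partial>distr M borel A)"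
      by (rule integral_distr[symmetric]) auto
    also have "\<dots> = (\<integral>x. min (B x) (real K) \<partial>M)"
      unfolding law by (rule integral_distr) auto
    finally show ?thesis by simp
  qed
  have "(\<lambda>K. \<integral>x. m K x \<partial>M) \<longlonglongrightarrow> (\<integral>x. h x \<partial>M)"
  proof (rule integral_dominated_convergence[where w = "\<lambda>x. \<bar>h x\<bar>"])
    show "AE x in M. (\<lambda>K. m K x) \<longlonglongrightarrow> h x"
      using le
    proof eventually_elim
      case (elim x)
      have "eventually (\<lambda>K. m K x = h x) sequentially"
        using eventually_ge_at_top[of "nat \<lceil>A x\<rceil> + nat \<lceil>B x\<rceil>"]
      proof eventually_elim
        case (elim K)
        then have "A x \<le> real K" "B x \<le> real K" by linarith+
        then show ?case using \<open>h x \<le> A x - B x\<close> by (simp add: m_def)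
      qed
      then show ?case by (rule tendsto_eventually)
    qed
  qed (use h bound in auto)
  then show ?thesis by (rule LIMSEQ_le_const2) (use m_le in auto)
qed

lemma orthogonal_projection_exists:
  fixes W :: "'a::euclidean_space set"
  assumes "subspace W"
  obtains p where "linear p" "\<And>v. p v \<in> W" "\<And>v w. w \<in> W \<Longrightarrow> p v \<bullet> w = v \<bullet> w"
proof -
  obtain B where B: "B \<subseteq> W" "pairwise orthogonal B" "independent B" "span B = W"
    using orthonormal_basis_subspace[OF assms] by metis
  define p where "p v = (\<Sum>b\<in>B. (b \<bullet> v / (b \<bullet> b)) *\<^sub>R b)" for v
  have "linear p"
    unfolding p_def by (rule linearI) (simp_all add: inner_add_right add_divide_distrib scaleR_add_left sum.distrib scaleR_sum_right)
  moreover have "p v \<in> W" for v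
    unfolding p_def using B assms by (intro subspace_sum subspace_scale) auto
  moreover have "p v \<bullet> w = v \<bullet> w" if "w \<in> W" for v w
    using Gram_Schmidt_step[of B w v] B that by (simp add: p_def orthogonal_def inner_diff_right inner_commute)
  ultimately show ?thesis by (rule that)
qed

lemma transpose_invariant_onto:
  assumes "g \<in> GL" "subspace W" "transpose_blinfun g ` W \<subseteq> W"
  shows "transpose_blinfun g ` W = W"
proof (rule subspace_dim_equal)
  show "subspace (transpose_blinfun g ` W)"
    by (rule linear_subspace_image[OF linear_blinfun_apply assms(2)])
  have "inj (blinfun_apply (transpose_blinfun g))" using transpose_GL[OF assms(1)] by (simp add: GL_def bij_def)
  then have "dim (transpose_blinfun g ` W) = dim W"
    by (intro dim_image_eq linear_blinfun_apply) (auto intro: inj_on_subset)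
  then show "dim W \<le> dim (transpose_blinfun g ` W)" by simp
qed (use assms in auto)

text \<open>Invariance of \<open>W\<close> under the transpose gives that \<open>g\<close> preserves the orthogonal complement; the
  converse implication uses that the transpose maps \<open>W\<close> onto itself.\<close>

lemma orthogonal_comp_apply_iff:
  assumes "g \<in> GL" "subspace W" "transpose_blinfun g ` W \<subseteq> W"
  shows "blinfun_apply g v \<in> orthogonal_comp W \<longleftrightarrow> v \<in> orthogonal_comp W"
proof -
  have "blinfun_apply g v \<in> orthogonal_comp W \<longleftrightarrow> (\<forall>w\<in>W. v \<bullet> transpose_blinfun g w = 0)"
    by (simp add: orthogonal_comp_def orthogonal_def inner_transpose inner_commute[of _ "blinfun_apply g v"])
  also have "\<dots> \<longleftrightarrow> (\<forall>w\<in>transpose_blinfun g ` W. v \<bullet> w = 0)" by simp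
  also have "\<dots> \<longleftrightarrow> v \<in> orthogonal_comp W"
    unfolding transpose_invariant_onto[OF assms] 
    by (simp add: orthogonal_comp_def orthogonal_def inner_commute[of v])
  finally show ?thesis .
qed

text \<open>The map induced by \<open>g\<close> on the quotient by the orthogonal complement of \<open>W\<close> is dual to the
  transpose of \<open>g\<close> on \<open>W\<close>, and \<open>norm (p v)\<close> is the quotient norm.\<close>

lemma projection_growth:
  assumes W: "subspace W" "W \<noteq> {0}" and inv: "transpose_blinfun g ` W \<subseteq> W"
    and p: "\<And>v. p v \<in> W" "\<And>v w. w \<in> W \<Longrightarrow> p v \<bullet> w = v \<bullet> w"
  shows "norm (p (blinfun_apply g v)) \<le> norm_on W (transpose_blinfun g) * norm (p v)"
proof (cases "p (blinfun_apply g v) = 0")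
  case True
  then show ?thesis by (simp add: norm_on_nonneg[OF W])
next
  case False
  let ?u = "p (blinfun_apply g v)"
  have "norm ?u * norm ?u = ?u \<bullet> ?u" by (simp add: power2_norm_eq_inner[symmetric] power2_eq_square)
  also have "\<dots> = v \<bullet> transpose_blinfun g ?u" by (simp add: p inner_transpose)
  also have "\<dots> = p v \<bullet> transpose_blinfun g ?u" using inv p by (auto simp: image_subset_iff)
  also have "\<dots> \<le> norm (p v) * norm (transpose_blinfun g ?u)" by (rule norm_cauchy_schwarz)
  also have "\<dots> \<le> norm (p v) * (norm_on W (transpose_blinfun g) * norm ?u)"
    by (intro mult_left_mono apply_le_norm_on W p norm_ge_zero)
  finally show ?thesis using False by (simp add: mult_ac)
qed

context stationary_pair begin

lemma distr_snd: "distr (\<kappa> \<Otimes>\<^sub>M \<nu>) \<nu> snd = \<nu>"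
proof (rule measure_eqI)
  fix A assume "A \<in> sets (distr (\<kappa> \<Otimes>\<^sub>M \<nu>) \<nu> snd)"
  then have A: "A \<in> sets \<nu>" by simp
  have "snd -` A \<inter> space (\<kappa> \<Otimes>\<^sub>M \<nu>) = space \<kappa> \<times> A"
    using sets.sets_into_space[OF A] by (auto simp: space_pair_measure)
  then show "emeasure (distr (\<kappa> \<Otimes>\<^sub>M \<nu>) \<nu> snd) A = emeasure \<nu> A"
    using A by (simp add: emeasure_distr N.emeasure_pair_measure_Times K.emeasure_space_1)
qed simp

lemma
  assumes f: "integrable \<kappa> f" and D: "D \<in> sets \<nu>"
  shows integrable_fst_indicator: "integrable (\<kappa> \<Otimes>\<^sub>M \<nu>) (\<lambda>x. indicator D (snd x) * f (fst x) :: real)"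
    and integral_fst_indicator: "(\<integral>x. indicator D (snd x) * f (fst x) \<partial>(\<kappa> \<Otimes>\<^sub>M \<nu>)) = measure \<nu> D * (\<integral>g. f g \<partial>\<kappa>)"
proof -
  have [measurable]: "f \<in> borel_measurable \<kappa>" "D \<in> sets \<nu>" using assms by auto
  show int: "integrable (\<kappa> \<Otimes>\<^sub>M \<nu>) (\<lambda>x. indicator D (snd x) * f (fst x))"
    by (rule Bochner_Integration.integrable_bound[OF integrable_fst_coord[OF f]]) (auto simp: indicator_def)
  show "(\<integral>x. indicator D (snd x) * f (fst x) \<partial>(\<kappa> \<Otimes>\<^sub>M \<nu>)) = measure \<nu> D * (\<integral>g. f g \<partial>\<kappa>)"
    using integral_fst'[OF int] D by (simp add: N.emeasure_eq_measure)
qed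

lemma integrable_ln_norm_on_kappa:
  assumes m: "finite_first_moment \<kappa>" and W: "subspace W" "W \<noteq> {0}"
  shows "integrable \<kappa> (\<lambda>g. ln (norm_on W g))" "integrable \<kappa> (\<lambda>g. ln (norm_on W (transpose_blinfun g)))"
proof -
  have meas: "(\<lambda>g. ln (norm_on W g)) \<in> borel_measurable GL_borel"
    by (intro borel_measurable_GL_borel borel_measurable_ln measurable_norm_on W)
  have meas': "(\<lambda>g. ln (norm_on W (transpose_blinfun g))) \<in> borel_measurable GL_borel"
    by (rule measurable_compose[OF measurable_transpose_GL meas])
  note m' = m[unfolded finite_first_moment_iff]
  show "integrable \<kappa> (\<lambda>g. ln (norm_on W g))"
  proof (rule Bochner_Integration.integrable_bound[OF m'])
    show "AE g in \<kappa>. norm (ln (norm_on W g)) \<le> norm (ln (distortion g))"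
      by (intro AE_I2) (simp add: space_\<kappa>, use abs_ln_norm_on_le[OF W] in \<open>meson abs_ge_self order_trans\<close>)
  qed (use meas in \<open>simp add: measurable_cong_sets[OF sets_\<kappa> refl]\<close>)
  show "integrable \<kappa> (\<lambda>g. ln (norm_on W (transpose_blinfun g)))"
  proof (rule Bochner_Integration.integrable_bound[OF m'])
    show "AE g in \<kappa>. norm (ln (norm_on W (transpose_blinfun g))) \<le> norm (ln (distortion g))"
    proof (intro AE_I2)
      fix g assume "g \<in> space \<kappa>"
      then have g: "g \<in> GL" by (simp add: space_\<kappa>)
      have "ln (distortion (transpose_blinfun g)) \<le> ln (distortion g)"
        using distortion_transpose[OF g] distortion_ge_1[OF transpose_GL[OF g]] by (intro ln_mono) auto
      then show "norm (ln (norm_on W (transpose_blinfun g))) \<le> norm (ln (distortion g))"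
        using abs_ln_norm_on_le[OF W transpose_GL[OF g]] by simp
    qed
  qed (use meas' in \<open>simp add: measurable_cong_sets[OF sets_\<kappa> refl]\<close>)
qed

lemma log_cocycle_le_ln_norm:
  assumes "g \<in> GL" "L \<in> proj UNIV"
  shows "log_cocycle g L \<le> ln (norm_on UNIV g)"
proof -
  have U: "subspace (UNIV :: 'a set)" "(UNIV :: 'a set) \<noteq> {0}" by auto
  have v: "line_vector L \<noteq> 0" "blinfun_apply g (line_vector L) \<noteq> 0" using assms by (auto simp: line_vector GL_inj)
  then have "ln (norm (blinfun_apply g (line_vector L)) / norm (line_vector L)) \<le> ln (norm_on UNIV g)"
    by (intro ln_mono norm_on_ge_apply U) auto
  then show ?thesis by (simp add: log_cocycle_eq assms)
qed

lemma integral_log_cocycle_le: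
  assumes m: "finite_first_moment \<kappa>" and D: "D \<in> sets \<nu>"
  shows "(\<integral>x. indicator D (snd x) * log_cocycle (fst x) (snd x) \<partial>(\<kappa> \<Otimes>\<^sub>M \<nu>)) 
    \<le> measure \<nu> D * (\<integral>g. ln (norm_on UNIV g) \<partial>\<kappa>)"
proof -
  have U: "subspace (UNIV :: 'a set)" "(UNIV :: 'a set) \<noteq> {0}" by auto
  note int = integrable_ln_norm_on_kappa(1)[OF m U]
  have [measurable]: "D \<in> sets \<nu>" by (rule D)
  have "(\<integral>x. indicator D (snd x) * log_cocycle (fst x) (snd x) \<partial>(\<kappa> \<Otimes>\<^sub>M \<nu>)) 
    \<le> (\<integral>x. indicator D (snd x) * ln (norm_on UNIV (fst x)) \<partial>(\<kappa> \<Otimes>\<^sub>M \<nu>))"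
  proof (rule integral_mono)
    show "integrable (\<kappa> \<Otimes>\<^sub>M \<nu>) (\<lambda>x. indicator D (snd x) * log_cocycle (fst x) (snd x))"
      by (rule Bochner_Integration.integrable_bound[OF integrable_log_cocycle[OF m]])
         (use integrable_log_cocycle[OF m] in \<open>auto simp: indicator_def\<close>)
    show "integrable (\<kappa> \<Otimes>\<^sub>M \<nu>) (\<lambda>x. indicator D (snd x) * ln (norm_on UNIV (fst x)))"
      by (rule integrable_fst_indicator[OF int D])
  qed (auto simp: space_pair indicator_def log_cocycle_le_ln_norm)
  then show ?thesis by (simp add: integral_fst_indicator[OF int D])
qed

corollary cocycle_average_le_mean_log_norm:
  assumes "finite_first_moment \<kappa>"
  shows "cocycle_average \<kappa> \<nu> \<le> (\<integral>g. ln (norm_on UNIV g) \<partial>\<kappa>)"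
proof -
  have "cocycle_average \<kappa> \<nu> = (\<integral>x. indicator (space \<nu>) (snd x) * log_cocycle (fst x) (snd x) \<partial>(\<kappa> \<Otimes>\<^sub>M \<nu>))"
    unfolding cocycle_average_eq[OF assms] by (rule Bochner_Integration.integral_cong) (auto simp: space_pair_measure)
  also have "\<dots> \<le> measure \<nu> (space \<nu>) * (\<integral>g. ln (norm_on UNIV g) \<partial>\<kappa>)"
    by (rule integral_log_cocycle_le[OF assms]) simp
  finally show ?thesis by (simp add: N.prob_space)
qed

lemma nonorthogonal_lines_measurable:
  "{L \<in> proj UNIV. line_vector L \<notin> orthogonal_comp W} \<in> sets \<nu>"
proof -
  have "closed (orthogonal_comp W)" by (intro closed_subspace subspace_orthogonal_comp)
  then have [measurable]: "orthogonal_comp W \<in> sets borel" by (rule borel_closed)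
  have "{L \<in> space proj_borel. line_vector L \<notin> orthogonal_comp W} \<in> sets proj_borel" by measurable
  then show ?thesis by (simp add: sets_\<nu>)
qed

text \<open>The recurrence argument for a single step. With \<open>D\<close> the set of lines that are not orthogonal to
  \<open>W\<close>, the function \<open>\<phi>\<close> compares the norm of a vector with the quotient norm on \<open>D\<close> and is extended by
  zero. Almost every \<open>g\<close> preserves \<open>D\<close>, and there the increment of \<open>\<phi>\<close> dominates \<open>h\<close>, the cocycle
  minus the growth in the quotient; off \<open>D\<close> both \<open>h\<close> and \<open>\<phi>\<close> vanish.\<close>

proposition cocycle_average_split:
  assumes m: "finite_first_moment \<kappa>" and W: "subspace W" "W \<noteq> {0}" 
    and inv: "AE g in \<kappa>. transpose_blinfun g ` W \<subseteq> W"
  defines "t \<equiv> measure \<nu> {L \<in> proj UNIV. line_vector L \<notin> orthogonal_comp W}"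
  shows "cocycle_average \<kappa> \<nu> \<le> (1 - t) * (\<integral>g. ln (norm_on UNIV g) \<partial>\<kappa>) 
     + t * (\<integral>g. ln (norm_on W (transpose_blinfun g)) \<partial>\<kappa>)"
proof -
  define D where "D = {L \<in> proj UNIV. line_vector L \<notin> orthogonal_comp W}"
  have D [measurable]: "D \<in> sets \<nu>" unfolding D_def by (rule nonorthogonal_lines_measurable)
  obtain p where p: "linear p" "\<And>v. p v \<in> W" "\<And>v w. w \<in> W \<Longrightarrow> p v \<bullet> w = v \<bullet> w"
    using orthogonal_projection_exists[OF W(1)] by blast
  have p0: "p v = 0 \<longleftrightarrow> v \<in> orthogonal_comp W" for v
  proof
    assume "p v = 0"
    then show "v \<in> orthogonal_comp W" using p(3)[of _ v] by (auto simp: orthogonal_comp_def orthogonal_def inner_commute)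
  next
    assume "v \<in> orthogonal_comp W"
    then have "p v \<bullet> v = 0" using p(2) by (auto simp: orthogonal_comp_def orthogonal_def)
    then show "p v = 0" using p(3)[OF p(2), of v v] by (simp add: inner_commute)
  qed
  have p_le: "norm (p v) \<le> norm v" for v
  proof (cases "p v = 0")
    case False
    have "norm (p v) * norm (p v) = v \<bullet> p v" by (simp add: p power2_norm_eq_inner[symmetric] power2_eq_square flip: p(3)[OF p(2)])
    also have "\<dots> \<le> norm v * norm (p v)" by (rule norm_cauchy_schwarz)
    finally show ?thesis using False by simp
  qed simp
  define \<phi> where "\<phi> L = (if L \<in> D then ln (norm (line_vector L) / norm (p (line_vector L))) else 0)" for L
  have \<phi>_span: "\<phi> (span {v}) = ln (norm v / norm (p v)) \<and> span {v} \<in> D" if v: "v \<notin> orthogonal_comp W" for v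
  proof -
    have v0: "v \<noteq> 0" using v by (auto simp: orthogonal_comp_def orthogonal_def)
    then have L: "span {v} \<in> proj UNIV" by (auto simp: proj_def)
    have "line_vector (span {v}) \<in> span {v}" using line_vector(2)[OF L] span_base[of "line_vector (span {v})" "{line_vector (span {v})}"] by auto
    then obtain k where k: "line_vector (span {v}) = k *\<^sub>R v" by (auto simp: span_singleton)
    then have k0: "k \<noteq> 0" using line_vector(1)[OF L] by auto
    have pk: "p (k *\<^sub>R v) = k *\<^sub>R p v" using p(1) by (rule linear_scale)
    have "p (line_vector (span {v})) \<noteq> 0" using v k0 by (simp add: k pk p0)
    then have "span {v} \<in> D" using L by (simp add: D_def p0)
    then show ?thesis using k0 by (simp add: \<phi>_def k pk)
  qed
  have \<phi>_nonneg: "\<phi> L \<ge> 0" for L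
  proof (cases "L \<in> D")
    case True
    then have "p (line_vector L) \<noteq> 0" by (simp add: D_def p0)
    then show ?thesis using True p_le[of "line_vector L"] by (auto simp: \<phi>_def intro!: ln_ge_zero)
  qed (simp add: \<phi>_def)
  have pm [measurable]: "p \<in> borel_measurable borel"
    using linear_continuous_on[of p UNIV] p(1) by (intro borel_measurable_continuous_onI) (simp add: linear_conv_bounded_linear)
  have [measurable]: "line_vector \<in> borel_measurable \<nu>"
    using measurable_line_vector by (simp add: measurable_cong_sets[OF sets_\<nu> refl])
  have \<phi>\<nu>: "\<phi> \<in> borel_measurable \<nu>" unfolding \<phi>_def by measurable
  then have \<phi> [measurable]: "\<phi> \<in> borel_measurable proj_borel" by (simp add: measurable_cong_sets[OF sets_\<nu> refl])
  define w where "w g = ln (norm_on W (transpose_blinfun g))" for g :: "'a \<Rightarrow>\<^sub>L 'a"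
  have w_int: "integrable \<kappa> w" unfolding w_def by (rule integrable_ln_norm_on_kappa(2)[OF m W])
  define h where "h x = indicator D (snd x) * log_cocycle (fst x) (snd x) - indicator D (snd x) * w (fst x)" for x :: "('a \<Rightarrow>\<^sub>L 'a) \<times> 'a set"
  have lc_int: "integrable (\<kappa> \<Otimes>\<^sub>M \<nu>) (\<lambda>x. indicator E (snd x) * log_cocycle (fst x) (snd x))" if [measurable]: "E \<in> sets \<nu>" for E
    by (rule Bochner_Integration.integrable_bound[OF integrable_log_cocycle[OF m]])
       (use integrable_log_cocycle[OF m] in \<open>auto simp: indicator_def\<close>)
  have inv': "AE x in \<kappa> \<Otimes>\<^sub>M \<nu>. transpose_blinfun (fst x) ` W \<subseteq> W"
    by (rule AE_distrD[OF measurable_fst]) (unfold distr_fst, rule inv)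
  have "(\<integral>x. h x \<partial>(\<kappa> \<Otimes>\<^sub>M \<nu>)) \<le> 0"
  proof (rule P.integral_le_0_of_equal_laws)
    show "(\<lambda>x. \<phi> (proj_act (fst x) (snd x))) \<in> borel_measurable (\<kappa> \<Otimes>\<^sub>M \<nu>)"
      by (rule measurable_compose[OF act_measurable \<phi>])
    show "(\<lambda>x. \<phi> (snd x)) \<in> borel_measurable (\<kappa> \<Otimes>\<^sub>M \<nu>)"
      by (rule measurable_compose[OF measurable_snd \<phi>\<nu>])
    have "distr (\<kappa> \<Otimes>\<^sub>M \<nu>) borel (\<lambda>x. \<phi> (proj_act (fst x) (snd x))) = distr \<nu> borel \<phi>"
      using distr_distr[OF \<phi> act_measurable] by (simp add: distr_act comp_def)
    also have "\<dots> = distr (distr (\<kappa> \<Otimes>\<^sub>M \<nu>) \<nu> snd) borel \<phi>" by (simp add: distr_snd)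
    also have "\<dots> = distr (\<kappa> \<Otimes>\<^sub>M \<nu>) borel (\<lambda>x. \<phi> (snd x))"
      by (subst distr_distr[OF \<phi>\<nu> measurable_snd]) (simp add: comp_def)
    finally show "distr (\<kappa> \<Otimes>\<^sub>M \<nu>) borel (\<lambda>x. \<phi> (proj_act (fst x) (snd x))) = distr (\<kappa> \<Otimes>\<^sub>M \<nu>) borel (\<lambda>x. \<phi> (snd x))" .
    show "integrable (\<kappa> \<Otimes>\<^sub>M \<nu>) h"
      unfolding h_def by (intro Bochner_Integration.integrable_diff lc_int integrable_fst_indicator w_int D)
    show "AE x in \<kappa> \<Otimes>\<^sub>M \<nu>. h x \<le> \<phi> (proj_act (fst x) (snd x)) - \<phi> (snd x)"
      using inv' AE_space
    proof eventually_elim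
      case (elim x)
      define g where "g = fst x" define L where "L = snd x"
      have g: "g \<in> GL" "transpose_blinfun g ` W \<subseteq> W" and L: "L \<in> proj UNIV"
        using elim by (auto simp: space_pair g_def L_def)
      show ?case
      proof (cases "L \<in> D")
        case True
        define v where "v = line_vector L"
        have v: "v \<noteq> 0" "v \<notin> orthogonal_comp W" using True by (auto simp: D_def v_def line_vector)
        have gv: "blinfun_apply g v \<noteq> 0" "blinfun_apply g v \<notin> orthogonal_comp W"
          using v orthogonal_comp_apply_iff[OF g(1) W(1) g(2)] GL_inj[OF g(1)] by auto
        have pv: "p v \<noteq> 0" "p (blinfun_apply g v) \<noteq> 0" using v gv by (simp_all add: p0)
        have N: "norm_on W (transpose_blinfun g) > 0" by (rule norm_on_pos[OF W transpose_GL[OF g(1)]])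
        have "ln (norm (p (blinfun_apply g v))) \<le> ln (norm_on W (transpose_blinfun g) * norm (p v))"
          using pv projection_growth[OF W g(2) p(2,3), of v] by (intro ln_mono) auto
        also have "\<dots> = w g + ln (norm (p v))" unfolding w_def using N pv by (intro ln_mult_pos) auto
        finally have "ln (norm (p (blinfun_apply g v))) \<le> w g + ln (norm (p v))" .
        moreover have "\<phi> L = ln (norm v / norm (p v))" using True by (simp add: \<phi>_def v_def)
        moreover have "\<phi> (proj_act g L) = ln (norm (blinfun_apply g v) / norm (p (blinfun_apply g v)))"
          using \<phi>_span[OF gv(2)] by (simp add: proj_act_eq[OF L] v_def)
        moreover have "log_cocycle g L = ln (norm (blinfun_apply g v) / norm v)" by (simp add: log_cocycle_eq[OF L] v_def)
        moreover have "h x = log_cocycle g L - w g" using True by (simp add: h_def g_def L_def)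
        ultimately show ?thesis using v gv pv by (simp add: ln_div flip: g_def L_def)
      next
        case False
        then show ?thesis using \<phi>_nonneg by (simp add: h_def \<phi>_def[of L] flip: L_def)
      qed
    qed
  qed (simp_all add: \<phi>_nonneg)
  then have "(\<integral>x. indicator D (snd x) * log_cocycle (fst x) (snd x) \<partial>(\<kappa> \<Otimes>\<^sub>M \<nu>)) \<le> t * (\<integral>g. w g \<partial>\<kappa>)"
    unfolding h_def using lc_int[OF D] integrable_fst_indicator[OF w_int D] integral_fst_indicator[OF w_int D]
    by (simp add: t_def D_def)
  moreover have "(\<integral>x. indicator (space \<nu> - D) (snd x) * log_cocycle (fst x) (snd x) \<partial>(\<kappa> \<Otimes>\<^sub>M \<nu>)) 
    \<le> (1 - t) * (\<integral>g. ln (norm_on UNIV g) \<partial>\<kappa>)"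
    using integral_log_cocycle_le[OF m, of "space \<nu> - D"] N.prob_compl[OF D] D by (simp add: t_def D_def)
  moreover have "cocycle_average \<kappa> \<nu> = (\<integral>x. indicator D (snd x) * log_cocycle (fst x) (snd x) 
      + indicator (space \<nu> - D) (snd x) * log_cocycle (fst x) (snd x) \<partial>(\<kappa> \<Otimes>\<^sub>M \<nu>))"
    unfolding cocycle_average_eq[OF m] by (rule Bochner_Integration.integral_cong) (auto simp: space_pair_measure indicator_def)
  moreover have "\<dots> = (\<integral>x. indicator D (snd x) * log_cocycle (fst x) (snd x) \<partial>(\<kappa> \<Otimes>\<^sub>M \<nu>))
      + (\<integral>x. indicator (space \<nu> - D) (snd x) * log_cocycle (fst x) (snd x) \<partial>(\<kappa> \<Otimes>\<^sub>M \<nu>))"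
    by (intro Bochner_Integration.integral_add lc_int) auto
  ultimately show ?thesis unfolding w_def by linarith
qed

end

section \<open>The transposed walk\<close>

lemma rand_prod_cong: "(\<And>i. i < n \<Longrightarrow> \<omega> i = \<omega>' i) \<Longrightarrow> rand_prod \<omega> n = rand_prod \<omega>' n"
  by (induction n) auto

text \<open>Only the first \<open>n\<close> coordinates are reversed, so that the relabelling is a bijection of all
  indices.\<close>

lemma rand_prod_reverse_transpose:
  "rand_prod (\<lambda>i. transpose_blinfun (\<omega> (if i < n then n - Suc i else i))) n = transpose_blinfun (rand_prod \<omega> n)"
proof -
  have "rand_prod (\<lambda>i. transpose_blinfun (\<omega> (n - Suc i))) k = transpose_blinfun (rand_prod ((shift ^^ (n - k)) \<omega>) k)" if "k \<le> n" for k
    using that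
  proof (induction k)
    case 0
    show ?case by (simp add: transpose_id)
  next
    case (Suc k)
    define \<omega>' where "\<omega>' = (shift ^^ (n - Suc k)) \<omega>"
    have "(shift ^^ (n - k)) \<omega> = (shift ^^ 1) \<omega>'"
      unfolding \<omega>'_def shift_iterate
      by (rule ext, rule arg_cong[where f = \<omega>]) (use Suc.prems in simp)
    then have "rand_prod \<omega>' (1 + k) = rand_prod ((shift ^^ (n - k)) \<omega>) k o\<^sub>L rand_prod \<omega>' 1"
      by (simp only: rand_prod_add)
    moreover have "rand_prod \<omega>' 1 = \<omega> (n - Suc k)"
      by (rule blinfun_eqI) (simp add: \<omega>'_def shift_iterate)
    ultimately have "rand_prod \<omega>' (Suc k) = rand_prod ((shift ^^ (n - k)) \<omega>) k o\<^sub>L \<omega> (n - Suc k)" by simp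
    then show ?case using Suc unfolding \<omega>'_def[symmetric] by (simp add: transpose_compose)
  qed
  from this[of n] show ?thesis
    by (subst rand_prod_cong[where \<omega>' = "\<lambda>i. transpose_blinfun (\<omega> (n - Suc i))"]) auto
qed

lemma norm_on_UNIV_transpose: "norm_on UNIV (transpose_blinfun g) = norm_on UNIV (g :: 'a::euclidean_space \<Rightarrow>\<^sub>L 'a)"
proof -
  have U: "subspace (UNIV :: 'a set)" "(UNIV :: 'a set) \<noteq> {0}" by auto
  have *: "norm_on UNIV (transpose_blinfun g) \<le> norm_on UNIV g" for g :: "'a \<Rightarrow>\<^sub>L 'a"
    by (subst norm_on_le_iff[OF U norm_on_nonneg[OF U]]) (auto intro!: norm_transpose_apply_le apply_le_norm_on[OF U])
  show ?thesis using *[of g] *[of "transpose_blinfun g"] by (simp add: transpose_transpose)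
qed

lemma prob_on_GL_transpose_measure:
  assumes "prob_on_GL \<mu>"
  shows "prob_on_GL (transpose_measure \<mu>)"
  unfolding prob_on_GL_def transpose_measure_def
  using prob_space.prob_space_distr[OF prob_on_GL_D(1)[OF assms]] measurable_transpose_GL
  by (simp add: measurable_cong_sets[OF prob_on_GL_D(2)[OF assms] refl])

lemma finite_first_moment_transpose_measure:
  assumes GL: "prob_on_GL \<mu>" and m: "finite_first_moment \<mu>"
  shows "finite_first_moment (transpose_measure \<mu>)"
proof -
  have tr: "transpose_blinfun \<in> measurable \<mu> GL_borel"
    using measurable_transpose_GL by (simp add: measurable_cong_sets[OF prob_on_GL_D(2)[OF GL] refl])
  have meas: "(\<lambda>g :: 'a \<Rightarrow>\<^sub>L 'a. ln (distortion g)) \<in> borel_measurable GL_borel" by measurable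
  have "integrable \<mu> (\<lambda>g. ln (distortion (transpose_blinfun g)))"
  proof (rule Bochner_Integration.integrable_bound[OF m[unfolded finite_first_moment_iff]])
    show "AE g in \<mu>. norm (ln (distortion (transpose_blinfun g))) \<le> norm (ln (distortion g))"
    proof (rule AE_I2)
      fix g assume "g \<in> space \<mu>"
      then have g: "g \<in> GL" by (simp add: prob_on_GL_D(3)[OF GL])
      note ge = distortion_ge_1[OF transpose_GL[OF g]]
      then have "ln (distortion (transpose_blinfun g)) \<le> ln (distortion g)"
        using distortion_transpose[OF g] by (intro ln_mono) auto
      moreover have "0 \<le> ln (distortion (transpose_blinfun g))" using ge by simp
      ultimately show "norm (ln (distortion (transpose_blinfun g))) \<le> norm (ln (distortion g))" by simp
    qed
  qed (rule measurable_compose[OF tr meas])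
  then show ?thesis
    unfolding finite_first_moment_iff transpose_measure_def integrable_distr_eq[OF tr meas] .
qed

context random_walk begin

lemma transposed_walk: "random_walk (transpose_measure \<mu>)"
  by unfold_locales (intro prob_on_GL_transpose_measure finite_first_moment_transpose_measure GL moment)+

lemma mean_log_norm_eq:
  assumes W: "subspace W" "W \<noteq> {0}"
  shows "mean_log_norm \<mu> W n = (\<integral>g. ln (norm_on W g) \<partial>walk_law n)"
  unfolding mean_log_norm_def
  by (rule integral_walk_law[symmetric]) (intro borel_measurable_GL_borel borel_measurable_ln measurable_norm_on W)

text \<open>The relabelling \<open>\<sigma>\<close> together with the transpose carries the law of the factors of the walk to the
  law of the factors of the transposed walk, and product to transposed product.\<close>

lemma mean_log_norm_transpose:
  assumes W: "subspace W" "W \<noteq> {0}"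
  shows "mean_log_norm (transpose_measure \<mu>) W n = (\<integral>g. ln (norm_on W (transpose_blinfun g)) \<partial>walk_law n)"
proof -
  define \<sigma> where "\<sigma> i = (if i < n then n - Suc i else i)" for i
  have inj: "inj \<sigma>"
  proof (rule injI)
    fix i j assume "\<sigma> i = \<sigma> j" then show "i = j" by (simp add: \<sigma>_def split: if_splits)
  qed
  interpret T: random_walk "transpose_measure \<mu>" by (rule transposed_walk)
  have tr: "transpose_blinfun \<in> measurable \<mu> GL_borel"
    using measurable_transpose_GL by (simp add: measurable_cong_sets[OF sets_eq refl])
  then have tr': "transpose_blinfun \<in> measurable \<mu> (transpose_measure \<mu>)"
    by (simp add: measurable_cong_sets[OF refl T.sets_eq])
  have law: "distr P.S T.P.S (\<lambda>\<omega> i. transpose_blinfun (\<omega> (\<sigma> i))) = T.P.S"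
    by (rule distr_PiM_relabel[OF prob_space_axioms _ tr inj]) (simp add: transpose_measure_def)
  have meas: "(\<lambda>g. ln (norm_on W g)) \<in> borel_measurable GL_borel"
    by (intro borel_measurable_GL_borel borel_measurable_ln measurable_norm_on W)
  have map: "(\<lambda>\<omega> i. transpose_blinfun (\<omega> (\<sigma> i))) \<in> measurable P.S T.P.S"
    by (rule measurable_PiM_single') 
       (use tr' in \<open>auto simp: space_PiM PiE_iff dest: measurable_space\<close>)
  have "mean_log_norm (transpose_measure \<mu>) W n 
    = (\<integral>\<omega>. ln (norm_on W (rand_prod \<omega> n)) \<partial>distr P.S T.P.S (\<lambda>\<omega> i. transpose_blinfun (\<omega> (\<sigma> i))))"
    unfolding mean_log_norm_def law ..
  also have "\<dots> = (\<integral>\<omega>. ln (norm_on W (rand_prod (\<lambda>i. transpose_blinfun (\<omega> (\<sigma> i))) n)) \<partial>P.S)"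
    by (rule integral_distr[OF map measurable_compose[OF T.measurable_walk meas]])
  also have "\<dots> = (\<integral>\<omega>. ln (norm_on W (transpose_blinfun (rand_prod \<omega> n))) \<partial>P.S)"
    unfolding \<sigma>_def rand_prod_reverse_transpose ..
  also have "\<dots> = (\<integral>g. ln (norm_on W (transpose_blinfun g)) \<partial>walk_law n)"
    by (rule integral_walk_law[symmetric, OF measurable_compose[OF measurable_transpose_GL meas]])
  finally show ?thesis .
qed

lemma AE_walk_law_invariant:
  assumes W: "subspace W" and inv: "AE g in transpose_measure \<mu>. blinfun_apply g ` W \<subseteq> W"
  shows "AE g in walk_law n. transpose_blinfun g ` W \<subseteq> W"
proof -
  have tr: "transpose_blinfun \<in> measurable \<mu> GL_borel"
    using measurable_transpose_GL by (simp add: measurable_cong_sets[OF sets_eq refl])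
  have "AE g in \<mu>. transpose_blinfun g ` W \<subseteq> W"
    by (rule AE_distrD[OF tr]) (rule inv[unfolded transpose_measure_def])
  from AE_factor[OF this] have AE: "AE \<omega> in P.S. transpose_blinfun (rand_prod \<omega> n) ` W \<subseteq> W"
  proof eventually_elim
    case (elim \<omega>)
    then show ?case
      unfolding rand_prod_reverse_transpose[symmetric] by (intro rand_prod_invariant) auto
  qed
  have "closed (\<Inter>w\<in>W. (\<lambda>g::'a \<Rightarrow>\<^sub>L 'a. blinfun_apply g w) -` W)"
    by (intro closed_INT ballI continuous_closed_vimage closed_subspace W continuous_intros)
  also have "(\<Inter>w\<in>W. (\<lambda>g::'a \<Rightarrow>\<^sub>L 'a. blinfun_apply g w) -` W) = {g. blinfun_apply g ` W \<subseteq> W}" by auto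
  finally have [measurable]: "{g :: 'a \<Rightarrow>\<^sub>L 'a. blinfun_apply g ` W \<subseteq> W} \<in> sets borel" by (rule borel_closed)
  have "transpose_blinfun -` {g. blinfun_apply g ` W \<subseteq> W} \<inter> space GL_borel \<in> sets (GL_borel :: ('a \<Rightarrow>\<^sub>L 'a) measure)"
    by (rule measurable_sets[OF measurable_of_GL_borel[OF measurable_transpose_GL]]) measurable
  then have "{g \<in> space GL_borel. transpose_blinfun g ` W \<subseteq> W} \<in> sets (GL_borel :: ('a \<Rightarrow>\<^sub>L 'a) measure)"
    by (simp add: vimage_def Int_def conj_commute)
  then show ?thesis using AE unfolding walk_law_def by (subst AE_distr_iff[OF measurable_walk])
qed

end

section \<open>Stationary measures of maximal average\<close>

lemma unique_maximal_FKH_space: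
  assumes "is_FKH_space \<eta> i W"
  shows "FKH_space \<eta> i = W"
proof -
  have "(THE W. is_FKH_space \<eta> i W) = W"
    using assms by (intro the_equality) (auto simp: is_FKH_space_def)
  then show ?thesis using assms by (auto simp: FKH_space_def)
qed

theorem corollary1p7:
  fixes \<mu> :: "('a::euclidean_space \<Rightarrow>\<^sub>L 'a) measure"
    and \<nu> :: "'a set measure"
  assumes "prob_on_GL \<mu>"
    and "finite_first_moment \<mu>"
    and "stationary \<mu> \<nu>"
    and "cocycle_average \<mu> \<nu> = top_lyapunov \<mu>"
  shows "measure \<nu> (proj (orthogonal_comp (FKH_space (transpose_measure \<mu>) 2))) = 1"
proof -
  define \<eta> where "\<eta> = transpose_measure \<mu>"
  interpret random_walk \<mu> using assms by unfold_locales
  interpret T: random_walk \<eta> unfolding \<eta>_def by (rule transposed_walk)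
  interpret N: stationary_pair \<mu> \<nu> using assms by unfold_locales
  have U: "subspace (UNIV :: 'a set)" "(UNIV :: 'a set) \<noteq> {0}" by auto
  have AE_U: "AE g in \<mu>. blinfun_apply g ` UNIV \<subseteq> UNIV" by simp
  show ?thesis
  proof (cases "\<exists>W. is_FKH_space \<eta> 2 W")
    case False
    then have "FKH_space (transpose_measure \<mu>) 2 = {0}" by (simp add: FKH_space_def \<eta>_def)
    then show ?thesis using N.N.prob_space by (simp add: N.space_\<nu>)
  next
    case True
    then obtain W where FKH: "is_FKH_space \<eta> 2 W" by blast
    then have FKH_W: "FKH_space (transpose_measure \<mu>) 2 = W" by (simp add: unique_maximal_FKH_space \<eta>_def)
    define b where "b = top_lyapunov_on \<eta> W"
    have inv_W: "invariant_subspace \<eta> W" and W: "subspace W" "W \<noteq> {0}" and b: "is_FKH_exponent \<eta> 2 b"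
      using FKH by (auto simp: is_FKH_space_def has_FKH_exponent_def invariant_subspace_def b_def)
    have inv: "AE g in \<eta>. blinfun_apply g ` W \<subseteq> W" by (rule AE_invariant_subspace[OF T.GL inv_W])
    define \<Lambda> where "\<Lambda> = top_lyapunov \<mu>"
    have \<Lambda>: "\<Lambda> = (INF n\<in>{1..}. mean_log_norm \<mu> UNIV n / real n)"
      unfolding \<Lambda>_def by (rule furstenberg_kesten[OF U AE_U])
    have b_eq: "b = (INF n\<in>{1..}. mean_log_norm \<eta> W n / real n)"
      unfolding b_def by (rule T.furstenberg_kesten[OF W inv])
    have "b < \<Lambda>"
    proof -
      have "card {c \<in> FKH_exponents \<eta>. b \<le> c} = 2" using b by (simp add: is_FKH_exponent_def)
      then obtain c where c: "c \<in> FKH_exponents \<eta>" "b < c"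
        by (auto simp: card_2_iff) (metis (no_types, lifting) insertCI less_eq_real_def mem_Collect_eq)
      then obtain \<nu>' where \<nu>': "stationary \<eta> \<nu>'" "c = cocycle_average \<eta> \<nu>'"
        by (auto simp: FKH_exponents_def ergodic_stationary_def)
      have "c \<le> \<Lambda>" unfolding \<Lambda>
      proof (rule cINF_greatest)
        fix n :: nat assume "n \<in> {1..}"
        then obtain k where n: "n = Suc k" by (cases n) auto
        have "real n * c = cocycle_average (T.walk_law n) \<nu>'"
          using T.cocycle_average_walk_law[OF \<nu>'(1), of k] by (simp add: n \<nu>'(2))
        also have "\<dots> \<le> mean_log_norm \<eta> UNIV n"
          unfolding T.mean_log_norm_eq[OF U] n
          by (intro stationary_pair.cocycle_average_le_mean_log_norm T.stationary_walk_law \<nu>' T.finite_first_moment_walk_law)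
        also have "\<dots> = mean_log_norm \<mu> UNIV n"
          unfolding \<eta>_def mean_log_norm_transpose[OF U] norm_on_UNIV_transpose mean_log_norm_eq[OF U] ..
        finally show "c \<le> mean_log_norm \<mu> UNIV n / real n" by (simp add: n field_simps)
      qed simp
      then show ?thesis using c by simp
    qed
    define D where "D = {L \<in> proj UNIV. line_vector L \<notin> orthogonal_comp W}"
    have D: "D \<in> sets \<nu>" unfolding D_def by (rule N.nonorthogonal_lines_measurable)
    define t where "t = measure \<nu> D"
    have t: "0 \<le> t" "t \<le> 1" by (auto simp: t_def)
    have split: "real n * \<Lambda> \<le> (1 - t) * mean_log_norm \<mu> UNIV n + t * mean_log_norm \<eta> W n" if "n \<ge> 1" for n
    proof -
      from \<open>n \<ge> 1\<close> obtain k where n: "n = Suc k" by (cases n) simp_all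
      have "real n * \<Lambda> = cocycle_average (walk_law n) \<nu>"
        unfolding n cocycle_average_walk_law[OF assms(3)] using assms(4) by (simp add: \<Lambda>_def)
      also have "\<dots> \<le> (1 - t) * (\<integral>g. ln (norm_on UNIV g) \<partial>walk_law n) + t * (\<integral>g. ln (norm_on W (transpose_blinfun g)) \<partial>walk_law n)"
        unfolding t_def D_def n
        by (rule stationary_pair.cocycle_average_split[OF stationary_walk_law[OF assms(3)] finite_first_moment_walk_law W])
           (rule AE_walk_law_invariant[OF W(1) inv[unfolded \<eta>_def]])
      finally show ?thesis by (simp only: \<eta>_def mean_log_norm_transpose[OF W] mean_log_norm_eq[OF U])
    qed
    have "t = 0"
    proof (rule ccontr)
      assume "t \<noteq> 0"
      \<comment> \<open>half of what the convex combination \<open>(1 - t) \<Lambda> + t b\<close> falls short of \<open>\<Lambda>\<close>\<close>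
      define \<delta> where "\<delta> = t * (\<Lambda> - b) / 2"
      have \<delta>: "\<delta> > 0" using \<open>t \<noteq> 0\<close> t \<open>b < \<Lambda>\<close> by (simp add: \<delta>_def)
      have "\<exists>m\<in>{1..}. mean_log_norm \<mu> UNIV m / real m < \<Lambda> + \<delta>"
        using cINF_less_iff[OF _ bdd_below_mean_log_norm[OF U AE_U], of "\<Lambda> + \<delta>"] \<delta> unfolding \<Lambda>[symmetric] by simp
      then obtain m where m: "m \<ge> 1" "mean_log_norm \<mu> UNIV m / real m < \<Lambda> + \<delta>" by auto
      have "\<exists>k\<in>{1..}. mean_log_norm \<eta> W k / real k < b + \<delta>"
        using cINF_less_iff[OF _ T.bdd_below_mean_log_norm[OF W inv], of "b + \<delta>"] \<delta> unfolding b_eq[symmetric] by simp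
      then obtain k where k: "k \<ge> 1" "mean_log_norm \<eta> W k / real k < b + \<delta>" by auto
      \<comment> \<open>the infima are approached at different times \<open>m\<close> and \<open>k\<close>; their product serves both\<close>
      have "real (m * k) * \<Lambda> \<le> (1 - t) * mean_log_norm \<mu> UNIV (m * k) + t * mean_log_norm \<eta> W (k * m)"
        using split[of "m * k"] m k by (simp add: mult.commute)
      also have "\<dots> \<le> (1 - t) * (real k * mean_log_norm \<mu> UNIV m) + t * (real m * mean_log_norm \<eta> W k)"
        by (intro add_mono mult_left_mono mean_log_norm_mult U AE_U T.mean_log_norm_mult W inv) (use t in auto)
      also have "\<dots> \<le> (1 - t) * (real k * (real m * (\<Lambda> + \<delta>))) + t * (real m * (real k * (b + \<delta>)))"
        by (intro add_mono mult_left_mono) (use m k t in \<open>auto simp: field_simps\<close>)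
      also have "\<dots> = real (m * k) * (\<Lambda> - t * (\<Lambda> - b) + \<delta>)" by (simp add: algebra_simps)
      finally have "\<Lambda> \<le> \<Lambda> - t * (\<Lambda> - b) + \<delta>" using m k by (simp add: mult_le_cancel_left)
      moreover have "t * (\<Lambda> - b) = 2 * \<delta>" by (simp add: \<delta>_def)
      ultimately show False using \<delta> by linarith
    qed
    moreover have "proj (orthogonal_comp W) = space \<nu> - D"
    proof -
      have sub: "subspace (orthogonal_comp W)" by (rule subspace_orthogonal_comp)
      have "L \<in> proj (orthogonal_comp W) \<longleftrightarrow> line_vector L \<in> orthogonal_comp W" if L: "L \<in> proj UNIV" for L
      proof
        assume "L \<in> proj (orthogonal_comp W)"
        then obtain v where "v \<in> orthogonal_comp W" "L = span {v}" by (auto simp: proj_def)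
        then have "L \<subseteq> orthogonal_comp W" using span_minimal[of "{v}"] sub by auto
        then show "line_vector L \<in> orthogonal_comp W"
          using line_vector(2)[OF L] span_base[of "line_vector L" "{line_vector L}"] by auto
      next
        assume "line_vector L \<in> orthogonal_comp W"
        then show "L \<in> proj (orthogonal_comp W)"
          unfolding proj_def using line_vector[OF L] by (auto intro!: exI[of _ "line_vector L"])
      qed
      moreover have "proj (orthogonal_comp W) \<subseteq> proj UNIV" by (auto simp: proj_def)
      ultimately show ?thesis by (auto simp: N.space_\<nu> D_def)
    qed
    ultimately show ?thesis
      using N.N.prob_compl[OF D] by (simp add: FKH_W t_def)
  qed
qed

end
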